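(* Let $\Delta t>0$, $\tau>0$, let $\boldsymbol B_h^0\in \boldsymbol H_0^h(\mathrm{div})$ and $\boldsymbol A_h^0\in \boldsymbol H_0^h(\mathrm{curl})$ be given initial data, and suppose that for every $n\ge 0$ the fields $(\boldsymbol B_h^{n+1},\boldsymbol A_h^{n+1},\boldsymbol E_h^{n+1},\boldsymbol j_h^{n+1})\in \boldsymbol H_0^h(\mathrm{div})\times[\boldsymbol H_0^h(\mathrm{curl})]^3$ and the scalars $(\lambda_{\mathcal E,h}^{n+1},\lambda_{\mathcal H,h}^{n+1})\in\mathbb R^2$ satisfy, for all $(\boldsymbol C_h,\boldsymbol D_h,\boldsymbol F_h,\boldsymbol k_h)\in \boldsymbol H_0^h(\mathrm{div})\times[\boldsymbol H_0^h(\mathrm{curl})]^3$, $$\Big(\tfrac{\boldsymbol A_h^{n+1}-\boldsymbol A_h^n}{\Delta t},\boldsymbol D_h\Big)+(\boldsymbol E_h^{n+1},\boldsymbol D_h)+\lambda_{\mathcal H,h}^{n+1}(\boldsymbol B_h^{n+1},\boldsymbol D_h)+\lambda_{\mathcal E,h}^{n+1}(\boldsymbol j_h^{n+1},\boldsymbol D_h)=0,$$ $$(\boldsymbol B_h^{n+1},\boldsymbol C_h)-(\nabla\times\boldsymbol A_h^{n+1},\boldsymbol C_h)=0,$$ $$(\boldsymbol E_h^{n+1},\boldsymbol F_h)+\tau\big((\boldsymbol j_h^{n+1}\times\boldsymbol B_h^{n+1})\times\boldsymbol B_h^{n+1},\boldsymbol F_h\big)=0,$$ $$(\boldsymbol j_h^{n+1},\boldsymbol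 k_h)-(\boldsymbol B_h^{n+1},\nabla\times\boldsymbol k_h)=0,$$ $$\frac{\mathcal E_h^{n+1}-\mathcal E_h^n}{\Delta t}+2\tau\|\boldsymbol B_h^{n+1}\times\boldsymbol j_h^{n+1}\|^2=0,\qquad \mathcal H_h^{n+1}-\mathcal H_h^n=0,$$ where $\mathcal E_h^n=(\boldsymbol B_h^n,\boldsymbol B_h^n)$ and $\mathcal H_h^n=(\boldsymbol A_h^n,\boldsymbol B_h^n)$. Then for all $n\ge 0$: 1. (energy law) $\mathcal E_h^{n+1}\le \mathcal E_h^n\le\cdots\le\mathcal E_h^0$; 2. (discrete Gauss law) $\nabla\cdot\boldsymbol B_h^{n+1}=0$; 3. (global helicity conservation) $\mathcal H_h^{n+1}=\mathcal H_h^n=\cdots=\mathcal H_h^0$; 4. (discrete Arnold inequality) there is a constant $C>0$, independent of $n$, such that $|\mathcal H_h^{n}|\le C\,\mathcal E_h^{n}$ for all $n\ge0$.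
   Context: $\Omega\subset\mathbb R^3$ is a bounded contractible Lipschitz domain with outward unit normal $\boldsymbol n$. $(\cdot,\cdot)$ and $\|\cdot\|$ denote the $L^2(\Omega)$ inner product and norm (scalar- or vector-valued). $\boldsymbol H_0(\mathrm{curl})$ is the space of $L^2$ vector fields on $\Omega$ with $L^2$ curl and vanishing tangential trace on $\partial\Omega$; $\boldsymbol H_0(\mathrm{div})$ is the space of $L^2$ vector fields with $L^2$ divergence and vanishing normal trace; $L_0^2$ is the space of $L^2$ functions with zero mean. The spaces $H_0^{1,h}\subset H_0^1$, $\boldsymbol H_0^h(\mathrm{curl})\subset\boldsymbol H_0(\mathrm{curl})$, $\boldsymbol H_0^h(\mathrm{div})\subset\boldsymbol H_0(\mathrm{div})$, $L_0^{2,h}\subset L_0^2$ are finite-dimensional (finite element, piecewise polynomial) spaces forming a subcomplex $$0\to H_0^{1,h}\xrightarrow{\nabla}\boldsymbol H_0^h(\mathrm{curl})\xrightarrow{\nabla\times}\boldsymbol H_0^h(\mathrm{div})\xrightarrow{\nabla\cdot}L_0^{2,h}\to0$$ of the de Rham complex, which is assumed to be exact (e.g. Nédélec edge and Raviart–Thomas/Nédélec face elements on a mesh of $\Omega$). *)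

theory Defs
  imports "HOL-Analysis.Analysis"
begin

section \<open>Lipschitz domains\<close>

text \<open>
  Near every boundary point p the set is, in suitable orthonormal coordinates y centred at p,
  the region strictly above the graph of a Lipschitz function of two variables.
\<close>

definition lipschitz_domain :: "(real^3) set \<Rightarrow> bool" where
  "lipschitz_domain \<Omega> \<longleftrightarrow>
     open \<Omega> \<and> connected \<Omega> \<and> \<Omega> \<noteq> {} \<and>
     (\<forall>p\<in>frontier \<Omega>. \<exists>(Q :: real^3 \<Rightarrow> real^3) (\<gamma> :: real^2 \<Rightarrow> real) L r.
        orthogonal_transformation Q \<and> L-lipschitz_on UNIV \<gamma> \<and> r > 0 \<and>
        (\<forall>y\<in>ball 0 r. p + Q y \<in> \<Omega> \<longleftrightarrow> \<gamma> (vector [y$1, y$2]) < y$3))"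

section \<open>Square integrable functions\<close>

text \<open>
  Elements of \<open>L\<^sup>2(\<Omega>)\<close> are represented by functions on the whole space of which only the values
  on \<open>\<Omega>\<close> matter; equality in \<open>L\<^sup>2(\<Omega>)\<close> is equality almost everywhere on \<open>\<Omega>\<close>.
\<close>

definition L2 :: "(real^3) set \<Rightarrow> (real^3 \<Rightarrow> 'b::euclidean_space) set" where
  "L2 \<Omega> = {u. u \<in> borel_measurable (lebesgue_on \<Omega>) \<and>
              integrable (lebesgue_on \<Omega>) (\<lambda>x. (norm (u x))\<^sup>2)}"

definition L2_inner :: "(real^3) set \<Rightarrow> (real^3 \<Rightarrow> 'b::euclidean_space) \<Rightarrow> (real^3 \<Rightarrow> 'b) \<Rightarrow> real" where
  "L2_inner \<Omega> u v = (\<integral>x. u x \<bullet> v x \<partial>lebesgue_on \<Omega>)"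

definition L2_norm :: "(real^3) set \<Rightarrow> (real^3 \<Rightarrow> 'b::euclidean_space) \<Rightarrow> real" where
  "L2_norm \<Omega> u = sqrt (L2_inner \<Omega> u u)"

definition L2_eq :: "(real^3) set \<Rightarrow> (real^3 \<Rightarrow> 'b::euclidean_space) \<Rightarrow> (real^3 \<Rightarrow> 'b) \<Rightarrow> bool" where
  "L2_eq \<Omega> u v \<longleftrightarrow> (AE x in lebesgue_on \<Omega>. u x = v x)"

section \<open>Smooth functions and classical differential operators\<close>

definition partial :: "3 \<Rightarrow> (real^3 \<Rightarrow> 'b::euclidean_space) \<Rightarrow> real^3 \<Rightarrow> 'b" where
  "partial i f x = frechet_derivative f (at x) (axis i 1)"

text \<open>
  Total differentiability of all iterated partial derivatives is equivalent to being
  infinitely often continuously differentiable.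
\<close>

definition smooth :: "(real^3 \<Rightarrow> 'b::euclidean_space) \<Rightarrow> bool" where
  "smooth f \<longleftrightarrow> (\<forall>is x. foldr partial is f differentiable (at x))"

definition test_function :: "(real^3) set \<Rightarrow> (real^3 \<Rightarrow> 'b::euclidean_space) \<Rightarrow> bool" where
  "test_function \<Omega> f \<longleftrightarrow>
     smooth f \<and> compact (closure {x. f x \<noteq> 0}) \<and> closure {x. f x \<noteq> 0} \<subseteq> \<Omega>"

definition grad :: "(real^3 \<Rightarrow> real) \<Rightarrow> real^3 \<Rightarrow> real^3" where
  "grad \<phi> x = (\<chi> i. partial i \<phi> x)"

definition curl :: "(real^3 \<Rightarrow> real^3) \<Rightarrow> real^3 \<Rightarrow> real^3" where
  "curl v x = vector [partial 2 v x $ 3 - partial 3 v x $ 2,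
                      partial 3 v x $ 1 - partial 1 v x $ 3,
                      partial 1 v x $ 2 - partial 2 v x $ 1]"

definition dvg :: "(real^3 \<Rightarrow> real^3) \<Rightarrow> real^3 \<Rightarrow> real" where
  "dvg v x = (\<Sum>i\<in>UNIV. partial i v x $ i)"

section \<open>Weak differential operators\<close>

definition has_weak_grad :: "(real^3) set \<Rightarrow> (real^3 \<Rightarrow> real) \<Rightarrow> (real^3 \<Rightarrow> real^3) \<Rightarrow> bool" where
  "has_weak_grad \<Omega> \<phi> g \<longleftrightarrow> \<phi> \<in> L2 \<Omega> \<and> g \<in> L2 \<Omega> \<and>
     (\<forall>\<psi>. test_function \<Omega> \<psi> \<longrightarrow> L2_inner \<Omega> g \<psi> = - L2_inner \<Omega> \<phi> (dvg \<psi>))"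

definition has_weak_curl :: "(real^3) set \<Rightarrow> (real^3 \<Rightarrow> real^3) \<Rightarrow> (real^3 \<Rightarrow> real^3) \<Rightarrow> bool" where
  "has_weak_curl \<Omega> u w \<longleftrightarrow> u \<in> L2 \<Omega> \<and> w \<in> L2 \<Omega> \<and>
     (\<forall>\<psi>. test_function \<Omega> \<psi> \<longrightarrow> L2_inner \<Omega> w \<psi> = L2_inner \<Omega> u (curl \<psi>))"

definition has_weak_div :: "(real^3) set \<Rightarrow> (real^3 \<Rightarrow> real^3) \<Rightarrow> (real^3 \<Rightarrow> real) \<Rightarrow> bool" where
  "has_weak_div \<Omega> u d \<longleftrightarrow> u \<in> L2 \<Omega> \<and> d \<in> L2 \<Omega> \<and>
     (\<forall>\<psi>. test_function \<Omega> \<psi> \<longrightarrow> L2_inner \<Omega> d \<psi> = - L2_inner \<Omega> u (grad \<psi>))"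

text \<open>
  Weak derivatives are unique up to null sets; the following operators select a representative
  and are meaningful only where a weak derivative exists.
\<close>

definition weak_grad :: "(real^3) set \<Rightarrow> (real^3 \<Rightarrow> real) \<Rightarrow> real^3 \<Rightarrow> real^3" where
  "weak_grad \<Omega> \<phi> = (SOME g. has_weak_grad \<Omega> \<phi> g)"

definition weak_curl :: "(real^3) set \<Rightarrow> (real^3 \<Rightarrow> real^3) \<Rightarrow> real^3 \<Rightarrow> real^3" where
  "weak_curl \<Omega> u = (SOME w. has_weak_curl \<Omega> u w)"

definition weak_div :: "(real^3) set \<Rightarrow> (real^3 \<Rightarrow> real^3) \<Rightarrow> real^3 \<Rightarrow> real" where
  "weak_div \<Omega> u = (SOME d. has_weak_div \<Omega> u d)"

section \<open>The de Rham complex with boundary conditions\<close>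

definition H_curl :: "(real^3) set \<Rightarrow> (real^3 \<Rightarrow> real^3) set" where
  "H_curl \<Omega> = {u. \<exists>w. has_weak_curl \<Omega> u w}"

definition H_div :: "(real^3) set \<Rightarrow> (real^3 \<Rightarrow> real^3) set" where
  "H_div \<Omega> = {u. \<exists>d. has_weak_div \<Omega> u d}"

text \<open>
  The traces of fields in \<open>H(curl)\<close> and \<open>H(div)\<close> are functionals on the boundary, defined through
  Green's formulas: for smooth u with outward unit normal n, the functionals below are
  \<open>v \<mapsto> \<integral>\<^sub>\<partial>\<^sub>\<Omega> (n \<times> u) \<bullet> v\<close> and \<open>\<phi> \<mapsto> \<integral>\<^sub>\<partial>\<^sub>\<Omega> (u \<bullet> n) \<phi>\<close>. They are evaluated on functions that are smooth up
  to the boundary, which are dense in \<open>H\<^sup>1(\<Omega>)\<close> for Lipschitz domains.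
\<close>

definition tangential_trace ::
  "(real^3) set \<Rightarrow> (real^3 \<Rightarrow> real^3) \<Rightarrow> (real^3 \<Rightarrow> real^3) \<Rightarrow> real" where
  "tangential_trace \<Omega> u v = L2_inner \<Omega> (weak_curl \<Omega> u) v - L2_inner \<Omega> u (curl v)"

definition normal_trace ::
  "(real^3) set \<Rightarrow> (real^3 \<Rightarrow> real^3) \<Rightarrow> (real^3 \<Rightarrow> real) \<Rightarrow> real" where
  "normal_trace \<Omega> u \<phi> = L2_inner \<Omega> (weak_div \<Omega> u) \<phi> + L2_inner \<Omega> u (grad \<phi>)"

definition H0_curl :: "(real^3) set \<Rightarrow> (real^3 \<Rightarrow> real^3) set" where
  "H0_curl \<Omega> = {u \<in> H_curl \<Omega>. \<forall>v. smooth v \<longrightarrow> tangential_trace \<Omega> u v = 0}"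

definition H0_div :: "(real^3) set \<Rightarrow> (real^3 \<Rightarrow> real^3) set" where
  "H0_div \<Omega> = {u \<in> H_div \<Omega>. \<forall>\<phi>. smooth \<phi> \<longrightarrow> normal_trace \<Omega> u \<phi> = 0}"

text \<open>\<open>H\<^sub>0\<^sup>1(\<Omega>)\<close> is the closure of the test functions in the \<open>H\<^sup>1\<close> norm.\<close>

definition H0_1 :: "(real^3) set \<Rightarrow> (real^3 \<Rightarrow> real) set" where
  "H0_1 \<Omega> = {\<phi>. \<exists>g. has_weak_grad \<Omega> \<phi> g \<and>
     (\<exists>\<psi> :: nat \<Rightarrow> real^3 \<Rightarrow> real. (\<forall>k. test_function \<Omega> (\<psi> k)) \<and>
        (\<lambda>k. L2_norm \<Omega> (\<lambda>x. \<psi> k x - \<phi> x)) \<longlonglongrightarrow> 0 \<and>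
        (\<lambda>k. L2_norm \<Omega> (\<lambda>x. grad (\<psi> k) x - g x)) \<longlonglongrightarrow> 0)}"

definition L2_0 :: "(real^3) set \<Rightarrow> (real^3 \<Rightarrow> real) set" where
  "L2_0 \<Omega> = {q \<in> L2 \<Omega>. (\<integral>x. q x \<partial>lebesgue_on \<Omega>) = 0}"

section \<open>Finite element spaces\<close>

text \<open>
  The cells are arbitrary open sets, so that curved boundaries are allowed; interiors of the
  tetrahedra of a conforming mesh are a special case.
\<close>

definition mesh :: "(real^3) set \<Rightarrow> (real^3) set set \<Rightarrow> bool" where
  "mesh \<Omega> T \<longleftrightarrow> finite T \<and> (\<forall>K\<in>T. open K \<and> K \<noteq> {} \<and> K \<subseteq> \<Omega>) \<and>
     pairwise disjnt T \<and> negligible (\<Omega> - \<Union>T)"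

text \<open>
  Subspaces of \<open>L\<^sup>2(\<Omega>)\<close> are represented by sets of functions saturated under equality almost
  everywhere, i.e. by the union of the equivalence classes they contain; finite dimension
  refers to the quotient.
\<close>

definition L2_subspace :: "(real^3) set \<Rightarrow> (real^3 \<Rightarrow> 'b::euclidean_space) set \<Rightarrow> bool" where
  "L2_subspace \<Omega> V \<longleftrightarrow> V \<subseteq> L2 \<Omega> \<and> (\<lambda>x. 0) \<in> V \<and>
     (\<forall>u\<in>V. \<forall>v\<in>V. (\<lambda>x. u x + v x) \<in> V) \<and>
     (\<forall>c. \<forall>u\<in>V. (\<lambda>x. c *\<^sub>R u x) \<in> V) \<and>
     (\<forall>u\<in>V. \<forall>v. L2_eq \<Omega> u v \<longrightarrow> v \<in> V)"

definition L2_finite_dim :: "(real^3) set \<Rightarrow> (real^3 \<Rightarrow> 'b::euclidean_space) set \<Rightarrow> bool" where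
  "L2_finite_dim \<Omega> V \<longleftrightarrow>
     (\<exists>S. finite S \<and> S \<subseteq> V \<and> (\<forall>v\<in>V. \<exists>c. L2_eq \<Omega> v (\<lambda>x. \<Sum>b\<in>S. c b *\<^sub>R b x)))"

definition fe_space ::
  "(real^3) set \<Rightarrow> (real^3) set set \<Rightarrow> (real^3 \<Rightarrow> 'b::euclidean_space) set \<Rightarrow> bool" where
  "fe_space \<Omega> T V \<longleftrightarrow> L2_subspace \<Omega> V \<and> L2_finite_dim \<Omega> V \<and>
     (\<forall>u\<in>V. \<forall>K\<in>T. \<exists>p. polynomial_function p \<and> L2_eq K u p)"

definition de_rham_subcomplex ::
  "(real^3) set \<Rightarrow> (real^3 \<Rightarrow> real) set \<Rightarrow> (real^3 \<Rightarrow> real^3) set \<Rightarrow> (real^3 \<Rightarrow> real^3) set \<Rightarrow>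
   (real^3 \<Rightarrow> real) set \<Rightarrow> bool" where
  "de_rham_subcomplex \<Omega> V0 V1 V2 V3 \<longleftrightarrow>
     V0 \<subseteq> H0_1 \<Omega> \<and> V1 \<subseteq> H0_curl \<Omega> \<and> V2 \<subseteq> H0_div \<Omega> \<and> V3 \<subseteq> L2_0 \<Omega> \<and>
     weak_grad \<Omega> ` V0 \<subseteq> V1 \<and> weak_curl \<Omega> ` V1 \<subseteq> V2 \<and> weak_div \<Omega> ` V2 \<subseteq> V3"

text \<open>Exactness of \<open>0 \<rightarrow> V0 \<rightarrow> V1 \<rightarrow> V2 \<rightarrow> V3 \<rightarrow> 0\<close> at each of the four spaces.\<close>

definition exact_complex ::
  "(real^3) set \<Rightarrow> (real^3 \<Rightarrow> real) set \<Rightarrow> (real^3 \<Rightarrow> real^3) set \<Rightarrow> (real^3 \<Rightarrow> real^3) set \<Rightarrow>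
   (real^3 \<Rightarrow> real) set \<Rightarrow> bool" where
  "exact_complex \<Omega> V0 V1 V2 V3 \<longleftrightarrow>
     (\<forall>\<phi>\<in>V0. L2_eq \<Omega> (weak_grad \<Omega> \<phi>) (\<lambda>x. 0) \<longleftrightarrow> L2_eq \<Omega> \<phi> (\<lambda>x. 0)) \<and>
     (\<forall>u\<in>V1. L2_eq \<Omega> (weak_curl \<Omega> u) (\<lambda>x. 0) \<longleftrightarrow> (\<exists>\<phi>\<in>V0. L2_eq \<Omega> (weak_grad \<Omega> \<phi>) u)) \<and>
     (\<forall>v\<in>V2. L2_eq \<Omega> (weak_div \<Omega> v) (\<lambda>x. 0) \<longleftrightarrow> (\<exists>u\<in>V1. L2_eq \<Omega> (weak_curl \<Omega> u) v)) \<and>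
     (\<forall>q\<in>V3. \<exists>v\<in>V2. L2_eq \<Omega> (weak_div \<Omega> v) q)"

section \<open>Energy and helicity\<close>

definition energy :: "(real^3) set \<Rightarrow> (nat \<Rightarrow> real^3 \<Rightarrow> real^3) \<Rightarrow> nat \<Rightarrow> real" where
  "energy \<Omega> B n = L2_inner \<Omega> (B n) (B n)"

definition helicity ::
  "(real^3) set \<Rightarrow> (nat \<Rightarrow> real^3 \<Rightarrow> real^3) \<Rightarrow> (nat \<Rightarrow> real^3 \<Rightarrow> real^3) \<Rightarrow> nat \<Rightarrow> real" where
  "helicity \<Omega> A B n = L2_inner \<Omega> (A n) (B n)"

end

theory Submission
  imports Defs
begin

text \<open>
  The energy law, the Gauss law and the conservation of helicity are read off from the scheme.
  Testing \<open>(B, C) = (curl A, C)\<close> with \<open>C = B - curl A\<close>, which lies in \<open>V2\<close> because the spaces form a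
  complex, gives \<open>B = curl A\<close> almost everywhere, and exactness at \<open>V2\<close> turns this into \<open>div B = 0\<close>.

  The substance is the Arnold inequality \<open>\<bar>(u, curl u)\<bar> \<le> C \<parallel>curl u\<parallel>\<^sup>2\<close> on \<open>V1\<close>
  (\<open>discrete_Arnold_inequality\<close>). The semi-inner product \<open>q u v = (curl u, curl v)\<close> on the
  finite-dimensional space \<open>V1\<close> has, by the Gram-Schmidt process, a finite family \<open>Q\<close> with
  \<open>q u v = \<Sum>e\<in>Q. q u e * q e v\<close>. Hence \<open>u\<close> differs from \<open>p = \<Sum>e\<in>Q. q u e *\<^sub>R e\<close> by a field \<open>z\<close>
  with \<open>curl z = 0\<close>, while the coefficients of \<open>p\<close> are bounded by a multiple of \<open>\<parallel>curl u\<parallel>\<close>; the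
  subtraction of \<open>z\<close> plays the part of a gauge fixing and the bound that of a discrete Poincare
  inequality. The field \<open>z\<close> contributes nothing to \<open>(u, curl u)\<close>: by exactness it is the gradient of
  a function in \<open>H0_1\<close>, thus an \<open>L\<^sup>2\<close> limit of gradients of test functions, and these are orthogonal
  to the divergence-free field \<open>curl u\<close> (\<open>curl_free_orthogonal_to_curls\<close>).

  At time 0 the fields \<open>A\<close> and \<open>B\<close> are unrelated, so the inequality is obtained there by enlarging
  the constant; this is possible because zero energy forces zero helicity, by Cauchy-Schwarz.

  All of this computes with operators that are chosen representatives of weak derivatives. That
  the choice is immaterial up to null sets, and hence that \<open>weak_curl\<close> is linear almost everywhere,
  follows from the fundamental lemma of the calculus of variations, which in turn needs test functions that
  approximate the indicator of an open set.
\<close>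

section \<open>Test functions approximating open sets\<close>

text \<open>
  The constant polynomial 1 gives the standard function \<open>exp (-1/t)\<close> that is flat at 0 and tends to
  1 at infinity. The polynomial factor makes the family closed under differentiation.
\<close>

definition flat :: "real poly \<Rightarrow> real \<Rightarrow> real" where
  "flat q t = (if t > 0 then poly q (1 / t) * exp (- (1 / t)) else 0)"

lemma poly_times_exp_minus_tendsto_0:
  fixes q :: "real poly"
  shows "((\<lambda>s. poly q s * exp (- s)) \<longlongrightarrow> 0) at_top"
proof -
  have "((\<lambda>s. \<Sum>i\<le>degree q. coeff q i * (s ^ i / exp s)) \<longlongrightarrow> (\<Sum>i\<le>degree q. coeff q i * 0)) at_top"
    by (intro tendsto_sum tendsto_mult tendsto_const tendsto_power_div_exp_0)
  then show ?thesis
    by (simp add: poly_altdef exp_minus sum_distrib_right divide_inverse mult.assoc)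
qed

lemma flat_has_derivative:
  "(flat q has_real_derivative flat ([:0, 0, 1:] * (q - pderiv q)) t) (at t)"
proof -
  consider "t > 0" | "t < 0" | "t = 0" by linarith
  then show ?thesis
  proof cases
    case 1
    have "((\<lambda>t. poly q (1 / t) * exp (- (1 / t))) has_real_derivative
            poly ([:0, 0, 1:] * (q - pderiv q)) (1 / t) * exp (- (1 / t))) (at t)"
      using 1
      by (auto intro!: derivative_eq_intros poly_DERIV[THEN DERIV_chain2]
               simp: field_simps power2_eq_square)
    then have "(flat q has_real_derivative
            poly ([:0, 0, 1:] * (q - pderiv q)) (1 / t) * exp (- (1 / t))) (at t)"
      by (rule has_field_derivative_transform_within_open[of _ _ _ "{0<..}"])
         (use 1 in \<open>auto simp: flat_def\<close>)
    then show ?thesis using 1 by (simp add: flat_def)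
  next
    case 2
    have "((\<lambda>t. 0) has_real_derivative 0) (at t)" by simp
    then have "(flat q has_real_derivative 0) (at t)"
      by (rule has_field_derivative_transform_within_open[of _ _ _ "{..<0}"])
         (use 2 in \<open>auto simp: flat_def\<close>)
    then show ?thesis using 2 by (simp add: flat_def)
  next
    case 3
    \<comment> \<open>The difference quotient at 0 from the right is again of the form \<open>flat\<close>, with \<open>X * q\<close> for \<open>q\<close>.\<close>
    have "((\<lambda>h. poly ([:0, 1:] * q) (1 / h) * exp (- (1 / h))) \<longlongrightarrow> 0) (at_right (0::real))"
      using filterlim_compose[OF poly_times_exp_minus_tendsto_0[of "[:0, 1:] * q"] filterlim_inverse_at_top_right]
      by (simp add: inverse_eq_divide)
    then have "((\<lambda>h. flat q h / h) \<longlongrightarrow> 0) (at_right 0)"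
      by (rule Lim_transform_eventually)
         (auto simp: flat_def eventually_at_filter field_simps)
    moreover have "((\<lambda>h. flat q h / h) \<longlongrightarrow> 0) (at_left 0)"
      by (rule Lim_transform_eventually[OF tendsto_const])
         (auto simp: flat_def eventually_at_filter)
    ultimately have "((\<lambda>h. flat q h / h) \<longlongrightarrow> 0) (at 0)"
      by (simp add: filterlim_at_split)
    then show ?thesis using 3
      by (simp add: has_field_derivative_iff flat_def)
  qed
qed

text \<open>
  An algebra of functions that contains the bumps below and is closed under partial derivatives.
  Smoothness asks for differentiability of all iterated partial derivatives, so it follows for
  the whole algebra at once.
\<close>

inductive cutoff_algebra :: "(real^3 \<Rightarrow> real) \<Rightarrow> bool" where
  const: "cutoff_algebra (\<lambda>x. c)"
| flat: "cutoff_algebra (\<lambda>x. flat q (w \<bullet> x + a))"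
| add: "cutoff_algebra f \<Longrightarrow> cutoff_algebra g \<Longrightarrow> cutoff_algebra (\<lambda>x. f x + g x)"
| mult: "cutoff_algebra f \<Longrightarrow> cutoff_algebra g \<Longrightarrow> cutoff_algebra (\<lambda>x. f x * g x)"

lemma cutoff_algebra_prod:
  "finite I \<Longrightarrow> (\<And>i. i \<in> I \<Longrightarrow> cutoff_algebra (f i)) \<Longrightarrow> cutoff_algebra (\<lambda>x. \<Prod>i\<in>I. f i x)"
  by (induction I rule: finite_induct) (auto intro: cutoff_algebra.intros)

lemma cutoff_algebra_derivative:
  assumes "cutoff_algebra f"
  shows "\<exists>f'. (\<forall>x. (f has_derivative f' x) (at x)) \<and> (\<forall>v. cutoff_algebra (\<lambda>x. f' x v))"
  using assms
proof induction
  case (const c)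
  show ?case
    by (rule exI[of _ "\<lambda>x v. 0"]) (auto intro: cutoff_algebra.intros)
next
  case (flat q w a)
  let ?q = "[:0, 0, 1:] * (q - pderiv q)"
  have "((\<lambda>x. flat q (w \<bullet> x + a)) has_derivative (\<lambda>v. (w \<bullet> v) * flat ?q (w \<bullet> x + a))) (at x)" for x
  proof -
    have "((\<lambda>x. w \<bullet> x + a) has_derivative (\<lambda>v. w \<bullet> v)) (at x)"
      by (auto intro!: derivative_eq_intros)
    from has_derivative_compose[OF this flat_has_derivative[unfolded has_field_derivative_def]]
    show ?thesis by (simp add: mult.commute)
  qed
  then show ?case
    by (intro exI[of _ "\<lambda>x v. (w \<bullet> v) * flat ?q (w \<bullet> x + a)"])
       (auto intro: cutoff_algebra.intros)
next
  case (add f g)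
  then obtain f' g' where
    "\<And>x. (f has_derivative f' x) (at x)" "\<And>v. cutoff_algebra (\<lambda>x. f' x v)"
    "\<And>x. (g has_derivative g' x) (at x)" "\<And>v. cutoff_algebra (\<lambda>x. g' x v)" by blast
  then show ?case
    by (intro exI[of _ "\<lambda>x v. f' x v + g' x v"])
       (auto intro!: cutoff_algebra.intros has_derivative_add)
next
  case (mult f g)
  then obtain f' g' where
    "\<And>x. (f has_derivative f' x) (at x)" "\<And>v. cutoff_algebra (\<lambda>x. f' x v)"
    "\<And>x. (g has_derivative g' x) (at x)" "\<And>v. cutoff_algebra (\<lambda>x. g' x v)" by blast
  with mult.hyps show ?case
    by (intro exI[of _ "\<lambda>x v. f x * g' x v + f' x v * g x"])
       (auto intro!: cutoff_algebra.intros has_derivative_mult)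
qed

lemma cutoff_algebra_smooth:
  assumes "cutoff_algebra f"
  shows "smooth f"
proof -
  have partial: "cutoff_algebra (partial i g)" if g: "cutoff_algebra g" for i g
  proof -
    obtain g' where g': "\<And>x. (g has_derivative g' x) (at x)" "\<And>v. cutoff_algebra (\<lambda>x. g' x v)"
      using cutoff_algebra_derivative[OF g] by blast
    have "partial i g = (\<lambda>x. g' x (axis i 1))"
      using frechet_derivative_at[OF g'(1)] by (auto simp: partial_def fun_eq_iff)
    then show ?thesis using g'(2) by simp
  qed
  have "cutoff_algebra (foldr partial is f)" for "is"
    by (induction "is") (auto simp: assms intro: partial)
  then show ?thesis
    using cutoff_algebra_derivative unfolding smooth_def differentiable_def by blast
qed

lemma smooth_scaleR_const:
  fixes f :: "real^3 \<Rightarrow> real" and e :: "'b::euclidean_space"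
  assumes "smooth f"
  shows "smooth (\<lambda>x. f x *\<^sub>R e)"
proof -
  have d: "foldr partial is f differentiable (at x)" for "is" x
    using assms by (simp add: smooth_def)
  have "foldr partial is (\<lambda>x. f x *\<^sub>R e) = (\<lambda>x. foldr partial is f x *\<^sub>R e)" for "is"
  proof (induction "is")
    case (Cons i "is")
    have "frechet_derivative (\<lambda>x. foldr partial is f x *\<^sub>R e) (at x) =
          (\<lambda>v. frechet_derivative (foldr partial is f) (at x) v *\<^sub>R e)" for x
      by (intro frechet_derivative_at[symmetric] has_derivative_scaleR_left
            d[unfolded frechet_derivative_works])
    then show ?case unfolding foldr.simps comp_apply Cons.IH
      by (simp add: partial_def[abs_def])
  qed simp
  then show ?thesis
    using d by (auto simp: smooth_def intro!: derivative_intros)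
qed

lemma test_function_scaleR_const:
  fixes f :: "real^3 \<Rightarrow> real" and e :: "'b::euclidean_space"
  assumes "test_function \<Omega> f"
  shows "test_function \<Omega> (\<lambda>x. f x *\<^sub>R e)"
proof -
  have "closure {x. f x *\<^sub>R e \<noteq> 0} \<subseteq> closure {x. f x \<noteq> 0}"
    by (intro closure_mono) auto
  then show ?thesis
    using assms smooth_scaleR_const[of f e] closed_closure compact_Int_closed
    unfolding test_function_def by (metis (no_types, lifting) inf.absorb2 order_trans)
qed

text \<open>
  The shift by 1 makes the factors vanish already at distance \<open>1/m\<close> from the faces, so that the
  support is compact inside the open box; the factor \<open>m\<close> makes the values tend to 1 inside.
\<close>

definition box_cutoff :: "real^3 \<Rightarrow> real^3 \<Rightarrow> nat \<Rightarrow> real^3 \<Rightarrow> real" where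
  "box_cutoff a b m x = (\<Prod>i\<in>UNIV. flat 1 (real m * (x $ i - a $ i) - 1) * flat 1 (real m * (b $ i - x $ i) - 1))"

lemma flat_1_bounds: "0 \<le> flat 1 t" "flat 1 t \<le> 1"
  by (auto simp: flat_def)

lemma box_cutoff_bounds: "0 \<le> box_cutoff a b m x" "box_cutoff a b m x \<le> 1"
  unfolding box_cutoff_def
  by (auto intro!: prod_nonneg prod_le_1 mult_nonneg_nonneg mult_le_one flat_1_bounds)

lemma cutoff_algebra_box_cutoff: "cutoff_algebra (box_cutoff a b m)"
proof -
  have "cutoff_algebra (\<lambda>x. flat 1 (real m * (x $ i - a $ i) - 1))" for i
    using cutoff_algebra.flat[of 1 "axis i (real m)" "- real m * a $ i - 1"]
    by (simp add: inner_axis' algebra_simps)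
  moreover have "cutoff_algebra (\<lambda>x. flat 1 (real m * (b $ i - x $ i) - 1))" for i
    using cutoff_algebra.flat[of 1 "axis i (- real m)" "real m * b $ i - 1"]
    by (simp add: inner_axis' algebra_simps)
  ultimately have "cutoff_algebra (\<lambda>x. \<Prod>i\<in>UNIV. flat 1 (real m * (x $ i - a $ i) - 1) * flat 1 (real m * (b $ i - x $ i) - 1))"
    by (intro cutoff_algebra_prod cutoff_algebra.mult) auto
  then show ?thesis by (simp add: box_cutoff_def[abs_def])
qed

lemma flat_1_tendsto_1:
  assumes "c > 0"
  shows "(\<lambda>m. flat 1 (real m * c - 1)) \<longlonglongrightarrow> 1"
proof -
  have lim: "filterlim (\<lambda>m. real m * c - 1) at_top sequentially"
    using assms by (intro filterlim_tendsto_add_at_top[of "\<lambda>_. -1" "-1" _ "\<lambda>m. real m * c", simplified] filterlim_at_top_mult_tendsto_pos[of "\<lambda>_. c" c, simplified] filterlim_real_sequentially)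
  have "(\<lambda>m. exp (- (1 / (real m * c - 1)))) \<longlonglongrightarrow> 1"
    using tendsto_exp[OF tendsto_minus[OF tendsto_divide_0[OF tendsto_const
            filterlim_at_top_imp_at_infinity[OF lim], of 1]]] by simp
  moreover have "\<forall>\<^sub>F m in sequentially. real m * c - 1 > 0"
    using lim unfolding filterlim_at_top_dense by blast
  ultimately show ?thesis
    by (elim Lim_transform_eventually) (auto simp: flat_def elim!: eventually_mono)
qed

lemma box_cutoff_tendsto_1:
  assumes "x \<in> box a b"
  shows "(\<lambda>m. box_cutoff a b m x) \<longlonglongrightarrow> 1"
proof -
  have "(\<lambda>m. \<Prod>i\<in>UNIV. flat 1 (real m * (x $ i - a $ i) - 1) * flat 1 (real m * (b $ i - x $ i) - 1))
     \<longlonglongrightarrow> (\<Prod>i\<in>(UNIV::3 set). 1 * 1)"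
    using assms by (intro tendsto_prod tendsto_mult flat_1_tendsto_1) (auto simp: mem_box_cart)
  then show ?thesis by (simp add: box_cutoff_def)
qed

lemma box_cutoff_support:
  assumes "box_cutoff a b m x \<noteq> 0"
  shows "x \<in> cbox (a + (\<chi> i. 1 / real m)) (b - (\<chi> i. 1 / real m))"
proof -
  have *: "real m * (x $ i - a $ i) - 1 > 0 \<and> real m * (b $ i - x $ i) - 1 > 0" for i
    using assms by (auto simp: box_cutoff_def flat_def split: if_splits)
  then have "m > 0" using *[of 1] by (cases m) auto
  then show ?thesis using * by (auto simp: mem_box_cart field_simps less_imp_le)
qed

lemma cutoff_cbox_subset_box:
  assumes "m > 0"
  shows "cbox (a + (\<chi> i. 1 / real m)) (b - (\<chi> i. 1 / real m)) \<subseteq> box a b"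
proof
  fix x assume x: "x \<in> cbox (a + (\<chi> i. 1 / real m)) (b - (\<chi> i. 1 / real m))"
  have p: "1 / real m > 0" using assms by simp
  have "a $ i + 1 / real m \<le> x $ i \<and> x $ i \<le> b $ i - 1 / real m" for i
    using x by (auto simp: mem_box_cart)
  then have "a $ i < x $ i \<and> x $ i < b $ i" for i
    using p by (smt (verit))
  then show "x \<in> box a b" by (auto simp: mem_box_cart)
qed

lemma open_eq_Union_box_sequence:
  fixes U :: "(real^3) set"
  assumes "open U"
  obtains a b :: "nat \<Rightarrow> real^3" where "U = (\<Union>k. box (a k) (b k))"
proof -
  obtain D where D: "countable D" "D \<subseteq> Pow U" "\<And>X. X \<in> D \<Longrightarrow> \<exists>a b. X = box a b" "\<Union>D = U"
    using open_countable_Union_open_box[OF assms] by metis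
  have D': "\<exists>a b. X = box a b" if "X \<in> insert {} D" for X
    using that D(3) by (metis insertE box_idem)
  \<comment> \<open>The empty box is added so that there is something to enumerate when \<open>U\<close> is empty.\<close>
  define X where "X = from_nat_into (insert {} D)"
  have "X k \<in> insert {} D" for k
    unfolding X_def by (rule from_nat_into) simp
  then have "\<forall>k. \<exists>p. X k = box (fst p) (snd p)"
    using D' by (metis fst_conv snd_conv)
  then obtain p where "\<And>k. X k = box (fst (p k)) (snd (p k))" by metis
  moreover have "range X = insert {} D"
    unfolding X_def using D(1) by (intro range_from_nat_into) auto
  then have "U = (\<Union>k. X k)" using D(4) by auto
  ultimately show ?thesis using that[of "\<lambda>k. fst (p k)" "\<lambda>k. snd (p k)"] by simp
qed

text \<open>
  The open set is a union of countably many boxes. With bumps \<open>b\<^sub>k\<close> for these boxes, the functions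
  \<open>1 - (\<Prod>k<m. 1 - b\<^sub>k)\<close> are supported in finitely many closed boxes, and at a point of the k-th box
  the single factor \<open>1 - b\<^sub>k\<close> already drives the product to 0.
\<close>

lemma open_indicator_limit_of_test_functions:
  fixes U :: "(real^3) set"
  assumes "open U"
  obtains \<eta> :: "nat \<Rightarrow> real^3 \<Rightarrow> real" where
    "\<And>m. test_function U (\<eta> m)" "\<And>m x. \<bar>\<eta> m x\<bar> \<le> 1" "\<And>m. \<eta> m \<in> borel_measurable borel"
    "\<And>x. (\<lambda>m. \<eta> m x) \<longlonglongrightarrow> indicator U x"
proof -
  obtain a b :: "nat \<Rightarrow> real^3" where U: "U = (\<Union>k. box (a k) (b k))"
    using open_eq_Union_box_sequence[OF assms] by blast
  define \<eta> where "\<eta> m x = 1 - (\<Prod>k<m. 1 - box_cutoff (a k) (b k) m x)" for m x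
  define Z where "Z m = (\<Union>k<m. cbox (a k + (\<chi> i. 1 / real m)) (b k - (\<chi> i. 1 / real m)))" for m
  have prod01: "0 \<le> (\<Prod>k\<in>I. 1 - box_cutoff (a k) (b k) m x)"
    "(\<Prod>k\<in>I. 1 - box_cutoff (a k) (b k) m x) \<le> 1" for I m x
    by (auto intro!: prod_nonneg prod_le_1 simp: box_cutoff_bounds)
  \<comment> \<open>For \<open>m = 0\<close> the margin \<open>1 / real m\<close> is 0, but then \<open>Z m\<close> is an empty union.\<close>
  have ZU: "Z m \<subseteq> U" and Zc: "compact (Z m)" for m
  proof -
    show "compact (Z m)" unfolding Z_def by (intro compact_UN) auto
    show "Z m \<subseteq> U"
      using cutoff_cbox_subset_box[of m] unfolding Z_def U by (cases "m = 0") fast+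
  qed
  have supp: "{x. \<eta> m x \<noteq> 0} \<subseteq> Z m" for m
  proof (rule ccontr)
    assume "\<not> {x. \<eta> m x \<noteq> 0} \<subseteq> Z m"
    then obtain x where x: "\<eta> m x \<noteq> 0" "x \<notin> Z m" by auto
    then have "box_cutoff (a k) (b k) m x = 0" if "k < m" for k
      using that box_cutoff_support unfolding Z_def by blast
    then show False using x(1) by (simp add: \<eta>_def)
  qed
  have alg: "cutoff_algebra (\<eta> m)" for m
  proof -
    have "cutoff_algebra (\<lambda>x. 1 + (-1) * (\<Prod>k<m. 1 + (-1) * box_cutoff (a k) (b k) m x))"
      by (intro cutoff_algebra.add cutoff_algebra.mult cutoff_algebra.const cutoff_algebra_prod
            cutoff_algebra_box_cutoff) auto
    then show ?thesis by (simp add: \<eta>_def[abs_def])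
  qed
  show ?thesis
  proof
    show "test_function U (\<eta> m)" for m
    proof -
      have "closure {x. \<eta> m x \<noteq> 0} \<subseteq> Z m"
        using supp Zc by (intro closure_minimal) (auto intro: compact_imp_closed)
      then show ?thesis
        using cutoff_algebra_smooth[OF alg] ZU[of m] Zc[of m] compact_Int_closed closed_closure
        unfolding test_function_def by (metis (no_types, lifting) inf.absorb2 order_trans)
    qed
    show "\<bar>\<eta> m x\<bar> \<le> 1" for m x using prod01[of m x "{..<m}"] by (simp add: \<eta>_def)
    show "\<eta> m \<in> borel_measurable borel" for m
      using cutoff_algebra_derivative[OF alg[of m]]
      by (intro borel_measurable_continuous_onI)
         (metis continuous_on_eq_continuous_at open_UNIV has_derivative_continuous)
    show "(\<lambda>m. \<eta> m x) \<longlonglongrightarrow> indicator U x" for x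
    proof (cases "x \<in> U")
      case False
      then have "\<eta> m x = 0" for m using supp ZU by blast
      then show ?thesis using False by simp
    next
      case True
      then obtain k where k: "x \<in> box (a k) (b k)" unfolding U by blast
      have le: "(\<Prod>k<m. 1 - box_cutoff (a k) (b k) m x) \<le> 1 - box_cutoff (a k) (b k) m x"
        if "m > k" for m
      proof -
        have "(\<Prod>k<m. 1 - box_cutoff (a k) (b k) m x) = (1 - box_cutoff (a k) (b k) m x) *
              (\<Prod>k\<in>{..<m} - {k}. 1 - box_cutoff (a k) (b k) m x)"
          using that by (intro prod.remove) auto
        also have "\<dots> \<le> (1 - box_cutoff (a k) (b k) m x) * 1"
          by (intro mult_left_mono prod01) (simp add: box_cutoff_bounds)
        finally show ?thesis by simp
      qed
      have "(\<lambda>m. \<Prod>k<m. 1 - box_cutoff (a k) (b k) m x) \<longlonglongrightarrow> 0"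
      proof (rule tendsto_sandwich[OF _ _ tendsto_const])
        show "(\<lambda>m. 1 - box_cutoff (a k) (b k) m x) \<longlonglongrightarrow> 0"
          using tendsto_diff[OF tendsto_const box_cutoff_tendsto_1[OF k], of 1] by simp
        show "\<forall>\<^sub>F m in sequentially. (\<Prod>k<m. 1 - box_cutoff (a k) (b k) m x)
                \<le> 1 - box_cutoff (a k) (b k) m x"
          using eventually_gt_at_top[of k] by eventually_elim (rule le)
      qed (simp add: prod01)
      from tendsto_diff[OF tendsto_const this, of 1] True show ?thesis
        by (simp add: \<eta>_def)
    qed
  qed
qed

section \<open>The fundamental lemma of the calculus of variations\<close>

lemma integral_open_subset_eq_0:
  fixes f :: "real^3 \<Rightarrow> real"
  assumes f: "integrable (lebesgue_on \<Omega>) f" and \<Omega>: "\<Omega> \<in> sets lebesgue"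
    and test: "\<And>\<psi>. test_function \<Omega> \<psi> \<Longrightarrow> (\<integral>x. f x * \<psi> x \<partial>lebesgue_on \<Omega>) = 0"
    and U: "open U" "U \<subseteq> \<Omega>"
  shows "(\<integral>x. f x * indicator U x \<partial>lebesgue_on \<Omega>) = 0"
proof -
  obtain \<eta> :: "nat \<Rightarrow> real^3 \<Rightarrow> real" where \<eta>:
    "\<And>m. test_function U (\<eta> m)" "\<And>m x. \<bar>\<eta> m x\<bar> \<le> 1" "\<And>m. \<eta> m \<in> borel_measurable borel"
    "\<And>x. (\<lambda>m. \<eta> m x) \<longlonglongrightarrow> indicator U x"
    using open_indicator_limit_of_test_functions[OF U(1)] by blast
  have meas: "g \<in> borel_measurable (lebesgue_on \<Omega>)" if "g \<in> borel_measurable borel" for g :: "real^3 \<Rightarrow> real"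
    using that by (intro measurable_restrict_space1) (simp add: measurable_completion)
  note [measurable] = meas[OF \<eta>(3)] borel_measurable_integrable[OF f]
  have "indicat_real U \<in> borel_measurable borel" using U(1) by simp
  note [measurable] = meas[OF this]
  have "(\<lambda>m. \<integral>x. f x * \<eta> m x \<partial>lebesgue_on \<Omega>) \<longlonglongrightarrow> (\<integral>x. f x * indicator U x \<partial>lebesgue_on \<Omega>)"
  proof (rule integral_dominated_convergence[where w = "\<lambda>x. \<bar>f x\<bar>"])
    show "AE x in lebesgue_on \<Omega>. (\<lambda>m. f x * \<eta> m x) \<longlonglongrightarrow> f x * indicator U x"
      by (intro AE_I2 tendsto_mult tendsto_const \<eta>(4))
    show "AE x in lebesgue_on \<Omega>. norm (f x * \<eta> m x) \<le> \<bar>f x\<bar>" for m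
      using \<eta>(2) by (intro AE_I2) (simp add: abs_mult mult_left_le)
  qed (use f in auto)
  moreover have "(\<integral>x. f x * \<eta> m x \<partial>lebesgue_on \<Omega>) = 0" for m
    using \<eta>(1)[of m] U(2) by (intro test) (auto simp: test_function_def)
  ultimately show ?thesis by (simp add: LIMSEQ_const_iff)
qed

text \<open>
  The set where \<open>f > 0\<close> agrees up to a null set with a decreasing intersection of open sets, over each
  of which \<open>f\<close> integrates to 0. By dominated convergence the positive part of \<open>f\<close> has integral 0.
\<close>

lemma AE_nonpos_if_weakly_zero:
  fixes f :: "real^3 \<Rightarrow> real"
  assumes f: "integrable (lebesgue_on \<Omega>) f" and \<Omega>: "open \<Omega>"
    and test: "\<And>\<psi>. test_function \<Omega> \<psi> \<Longrightarrow> (\<integral>x. f x * \<psi> x \<partial>lebesgue_on \<Omega>) = 0"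
  shows "AE x in lebesgue_on \<Omega>. f x \<le> 0"
proof -
  have \<Omega>': "\<Omega> \<in> sets lebesgue" using \<Omega> by (simp add: lmeasurable_iff_integrable borel_open)
  have [measurable]: "f \<in> borel_measurable (lebesgue_on \<Omega>)" using f by simp
  define P where "P = {x \<in> \<Omega>. f x > 0}"
  have "P \<in> sets (lebesgue_on \<Omega>)"
  proof -
    have "{x \<in> space (lebesgue_on \<Omega>). f x > 0} \<in> sets (lebesgue_on \<Omega>)" by measurable
    then show ?thesis by (simp add: P_def)
  qed
  then have P: "P \<in> sets lebesgue" using \<Omega>' by (simp add: sets_restrict_space_iff)
  obtain C N where C: "gdelta C" "N \<in> null_sets lebesgue" "P \<union> N = C" "disjnt P N"
    using lebesgue_set_almost_gdelta[OF P] by blast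
  obtain G :: "nat \<Rightarrow> (real^3) set" where G: "\<And>n. open (G n)" "C = (\<Inter>n. G n)"
    using C(1) by (auto simp: gdelta.simps)
  define W where "W n = \<Omega> \<inter> (\<Inter>k\<le>n. G k)" for n
  have W: "open (W n)" "W n \<subseteq> \<Omega>" for n
    using \<Omega> G(1) unfolding W_def by (auto intro!: open_Int open_INT)
  have meas: "indicat_real A \<in> borel_measurable (lebesgue_on \<Omega>)" if "A \<in> sets lebesgue" for A
    using that by (intro measurable_restrict_space1) simp
  have WS: "W n \<in> sets lebesgue" for n using W(1) by simp
  have CS: "C \<in> sets lebesgue" using P C(2,3) by (metis null_setsD2 sets.Un)
  note [measurable] = meas[OF WS] meas[OF CS]
  have "(\<lambda>n. \<integral>x. f x * indicator (W n) x \<partial>lebesgue_on \<Omega>) \<longlonglongrightarrow> (\<integral>x. f x * indicator C x \<partial>lebesgue_on \<Omega>)"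
  proof (rule integral_dominated_convergence[where w = "\<lambda>x. \<bar>f x\<bar>"])
    have "(\<lambda>n. indicator (W n) x) \<longlonglongrightarrow> indicat_real C x" if "x \<in> \<Omega>" for x
    proof (cases "x \<in> C")
      case True
      then have "indicator (W n) x = (1::real)" for n using that G(2) by (simp add: W_def)
      then show ?thesis using True by simp
    next
      case False
      then obtain k where k: "x \<notin> G k" using G(2) by blast
      have "\<forall>\<^sub>F n in sequentially. 0 = indicat_real (W n) x"
        using eventually_ge_at_top[of k] by eventually_elim (use k in \<open>auto simp: W_def indicator_def\<close>)
      then have "(\<lambda>n. indicat_real (W n) x) \<longlonglongrightarrow> 0"
        by (rule Lim_transform_eventually[OF tendsto_const])
      then show ?thesis using False by simp
    qed
    then show "AE x in lebesgue_on \<Omega>. (\<lambda>n. f x * indicator (W n) x) \<longlonglongrightarrow> f x * indicator C x"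
      by (intro AE_I2 tendsto_mult tendsto_const) simp
    show "AE x in lebesgue_on \<Omega>. norm (f x * indicator (W n) x) \<le> \<bar>f x\<bar>" for n
      by (intro AE_I2) (simp add: indicator_def)
  qed (use f in simp_all)
  then have "(\<integral>x. f x * indicator C x \<partial>lebesgue_on \<Omega>) = 0"
    using integral_open_subset_eq_0[OF f \<Omega>' test W] by (simp add: LIMSEQ_const_iff)
  moreover have "(\<integral>x. f x * indicator C x \<partial>lebesgue_on \<Omega>) = (\<integral>x. max 0 (f x) \<partial>lebesgue_on \<Omega>)"
  proof (rule integral_cong_AE)
    have "AE x in lebesgue. x \<notin> N" using C(2) AE_not_in by blast
    then have "AE x in lebesgue_on \<Omega>. x \<notin> N"
      using \<Omega>' by (subst AE_restrict_space_iff) (auto elim: eventually_mono)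
    then show "AE x in lebesgue_on \<Omega>. f x * indicator C x = max 0 (f x)"
    proof (rule AE_mp, intro AE_I2 impI)
      fix x assume "x \<in> space (lebesgue_on \<Omega>)" "x \<notin> N"
      then show "f x * indicator C x = max 0 (f x)"
        using C(3) by (auto simp: P_def indicator_def)
    qed
  qed simp_all
  ultimately have "(\<integral>x. max 0 (f x) \<partial>lebesgue_on \<Omega>) = 0" by simp
  then have "AE x in lebesgue_on \<Omega>. max 0 (f x) = 0"
    using f by (subst (asm) integral_nonneg_eq_0_iff_AE) auto
  then show ?thesis by eventually_elim simp
qed

lemma fundamental_lemma_of_calculus_of_variations:
  fixes f :: "real^3 \<Rightarrow> real"
  assumes f: "integrable (lebesgue_on \<Omega>) f" and \<Omega>: "open \<Omega>"
    and test: "\<And>\<psi>. test_function \<Omega> \<psi> \<Longrightarrow> (\<integral>x. f x * \<psi> x \<partial>lebesgue_on \<Omega>) = 0"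
  shows "AE x in lebesgue_on \<Omega>. f x = 0"
proof -
  have "AE x in lebesgue_on \<Omega>. - f x \<le> 0"
    using assms by (intro AE_nonpos_if_weakly_zero) auto
  moreover have "AE x in lebesgue_on \<Omega>. f x \<le> 0"
    using assms by (rule AE_nonpos_if_weakly_zero)
  ultimately show ?thesis
    by eventually_elim simp
qed

section \<open>The inner product of square integrable functions\<close>

lemma L2_add: "u \<in> L2 \<Omega> \<Longrightarrow> v \<in> L2 \<Omega> \<Longrightarrow> (\<lambda>x. u x + v x) \<in> L2 \<Omega>"
proof -
  assume u: "u \<in> L2 \<Omega>" and v: "v \<in> L2 \<Omega>"
  have [measurable]: "u \<in> borel_measurable (lebesgue_on \<Omega>)" "v \<in> borel_measurable (lebesgue_on \<Omega>)"
    using u v by (auto simp: L2_def)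
  have "integrable (lebesgue_on \<Omega>) (\<lambda>x. (norm (u x + v x))\<^sup>2)"
  proof (rule Bochner_Integration.integrable_bound)
    show "integrable (lebesgue_on \<Omega>) (\<lambda>x. 2 * (norm (u x))\<^sup>2 + 2 * (norm (v x))\<^sup>2)"
      using u v by (auto simp: L2_def)
    have "(norm (u x + v x))\<^sup>2 \<le> 2 * (norm (u x))\<^sup>2 + 2 * (norm (v x))\<^sup>2" for x
      using inner_ge_zero[of "u x - v x"]
      by (simp add: power2_norm_eq_inner inner_simps inner_commute)
    then show "AE x in lebesgue_on \<Omega>. norm ((norm (u x + v x))\<^sup>2)
        \<le> norm (2 * (norm (u x))\<^sup>2 + 2 * (norm (v x))\<^sup>2)"
      by (intro AE_I2) simp
  qed measurable
  then show ?thesis by (simp add: L2_def)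
qed

lemma L2_scale: "u \<in> L2 \<Omega> \<Longrightarrow> (\<lambda>x. c *\<^sub>R u x) \<in> L2 \<Omega>"
  by (auto simp: L2_def power_mult_distrib)

lemma L2_integrable_inner:
  assumes u: "u \<in> L2 \<Omega>" and v: "v \<in> L2 \<Omega>"
  shows "integrable (lebesgue_on \<Omega>) (\<lambda>x. u x \<bullet> v x)"
proof (rule Bochner_Integration.integrable_bound)
  have [measurable]: "u \<in> borel_measurable (lebesgue_on \<Omega>)" "v \<in> borel_measurable (lebesgue_on \<Omega>)"
    using u v by (auto simp: L2_def)
  show "integrable (lebesgue_on \<Omega>) (\<lambda>x. (norm (u x))\<^sup>2 + (norm (v x))\<^sup>2)"
    using u v by (auto simp: L2_def)
  show "(\<lambda>x. u x \<bullet> v x) \<in> borel_measurable (lebesgue_on \<Omega>)" by measurable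
  have "\<bar>u x \<bullet> v x\<bar> \<le> (norm (u x))\<^sup>2 + (norm (v x))\<^sup>2" for x
  proof -
    have "2 * (norm (u x) * norm (v x)) \<le> (norm (u x))\<^sup>2 + (norm (v x))\<^sup>2"
      using sum_squares_bound[of "norm (u x)" "norm (v x)"] by simp
    then show ?thesis using Cauchy_Schwarz_ineq2[of "u x" "v x"]
      by (smt (verit) mult_nonneg_nonneg norm_ge_zero)
  qed
  then show "AE x in lebesgue_on \<Omega>. norm (u x \<bullet> v x) \<le> norm ((norm (u x))\<^sup>2 + (norm (v x))\<^sup>2)"
    by (intro AE_I2) simp
qed

lemma L2_inner_commute: "L2_inner \<Omega> u v = L2_inner \<Omega> v u"
  by (simp add: L2_inner_def inner_commute)

lemma L2_inner_add_left:
  "u \<in> L2 \<Omega> \<Longrightarrow> v \<in> L2 \<Omega> \<Longrightarrow> w \<in> L2 \<Omega> \<Longrightarrow>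
   L2_inner \<Omega> (\<lambda>x. u x + v x) w = L2_inner \<Omega> u w + L2_inner \<Omega> v w"
  by (simp add: L2_inner_def inner_simps L2_integrable_inner)

lemma L2_inner_scale_left: "L2_inner \<Omega> (\<lambda>x. c *\<^sub>R u x) w = c * L2_inner \<Omega> u w"
  by (simp add: L2_inner_def)

lemma L2_inner_nonneg: "0 \<le> L2_inner \<Omega> u u"
  by (simp add: L2_inner_def)

lemma L2_inner_cong:
  assumes "L2_eq \<Omega> u u'" "u \<in> L2 \<Omega>" "u' \<in> L2 \<Omega>" "w \<in> L2 \<Omega>"
  shows "L2_inner \<Omega> u w = L2_inner \<Omega> u' w"
proof -
  have "AE x in lebesgue_on \<Omega>. u x \<bullet> w x = u' x \<bullet> w x"
    using assms(1) unfolding L2_eq_def by eventually_elim simp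
  then show ?thesis
    unfolding L2_inner_def using assms L2_integrable_inner[of _ \<Omega> w]
    by (intro integral_cong_AE) (auto dest: borel_measurable_integrable)
qed

lemma L2_eq_0_iff:
  assumes "u \<in> L2 \<Omega>"
  shows "L2_inner \<Omega> u u = 0 \<longleftrightarrow> L2_eq \<Omega> u (\<lambda>x. 0)"
  unfolding L2_inner_def L2_eq_def
  by (subst integral_nonneg_eq_0_iff_AE) (auto simp: L2_integrable_inner assms)

section \<open>Cauchy-Schwarz and Gram-Schmidt for degenerate forms\<close>

text \<open>
  The form may be degenerate: it is used for the \<open>L\<^sup>2\<close> inner product of functions that are only
  identified almost everywhere, and for \<open>(curl u, curl v)\<close>, whose kernel consists of the curl-free fields.
\<close>

locale semi_inner_product_space =
  fixes V :: "('a \<Rightarrow> 'b::real_vector) set" and q :: "('a \<Rightarrow> 'b) \<Rightarrow> ('a \<Rightarrow> 'b) \<Rightarrow> real"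
  assumes zero_mem: "(\<lambda>x. 0) \<in> V"
    and add_mem: "u \<in> V \<Longrightarrow> v \<in> V \<Longrightarrow> (\<lambda>x. u x + v x) \<in> V"
    and scale_mem: "u \<in> V \<Longrightarrow> (\<lambda>x. c *\<^sub>R u x) \<in> V"
    and add_left: "u \<in> V \<Longrightarrow> v \<in> V \<Longrightarrow> w \<in> V \<Longrightarrow> q (\<lambda>x. u x + v x) w = q u w + q v w"
    and scale_left: "u \<in> V \<Longrightarrow> w \<in> V \<Longrightarrow> q (\<lambda>x. c *\<^sub>R u x) w = c * q u w"
    and commute: "u \<in> V \<Longrightarrow> v \<in> V \<Longrightarrow> q u v = q v u"
    and nonneg: "u \<in> V \<Longrightarrow> q u u \<ge> 0"
begin

lemma diff_mem: "u \<in> V \<Longrightarrow> v \<in> V \<Longrightarrow> (\<lambda>x. u x - v x) \<in> V"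
  using add_mem[of u "\<lambda>x. (-1) *\<^sub>R v x"] scale_mem[of v "-1"] by simp

lemma diff_left: "u \<in> V \<Longrightarrow> v \<in> V \<Longrightarrow> w \<in> V \<Longrightarrow> q (\<lambda>x. u x - v x) w = q u w - q v w"
  using add_left[of u "\<lambda>x. (-1) *\<^sub>R v x" w] scale_mem[of v "-1"] scale_left[of v w "-1"] by simp

lemma sum_mem:
  "finite I \<Longrightarrow> (\<And>i. i \<in> I \<Longrightarrow> f i \<in> V) \<Longrightarrow> (\<lambda>x. \<Sum>i\<in>I. c i *\<^sub>R f i x) \<in> V"
proof (induction I rule: finite_induct)
  case (insert i I)
  then have "(\<lambda>x. c i *\<^sub>R f i x + (\<Sum>i\<in>I. c i *\<^sub>R f i x)) \<in> V"
    by (intro add_mem scale_mem) auto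
  then show ?case using insert.hyps by simp
qed (simp add: zero_mem)

lemma sum_left:
  assumes "finite I" "\<And>i. i \<in> I \<Longrightarrow> f i \<in> V" "w \<in> V"
  shows "q (\<lambda>x. \<Sum>i\<in>I. c i *\<^sub>R f i x) w = (\<Sum>i\<in>I. c i * q (f i) w)"
  using assms(1,2)
proof (induction I rule: finite_induct)
  case empty
  show ?case using scale_left[OF zero_mem assms(3), of 0] by simp
next
  case (insert i I)
  then show ?case
    using assms(3) by (simp add: add_left sum_mem scale_mem scale_left)
qed

text \<open>
  Nonnegativity of \<open>q (u + t v) (u + t v)\<close> for all \<open>t\<close>. In the degenerate case \<open>q v v = 0\<close> the
  quadratic polynomial in \<open>t\<close> is linear, so its slope \<open>q u v\<close> must vanish.
\<close>

lemma Cauchy_Schwarz: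
  assumes u: "u \<in> V" and v: "v \<in> V"
  shows "\<bar>q u v\<bar> \<le> sqrt (q u u) * sqrt (q v v)"
proof -
  have expand: "0 \<le> q u u + 2 * t * q u v + t\<^sup>2 * q v v" for t
  proof -
    let ?w = "\<lambda>x. u x + t *\<^sub>R v x"
    have w: "?w \<in> V" "(\<lambda>x. t *\<^sub>R v x) \<in> V" using u v by (auto intro: add_mem scale_mem)
    have "q ?w u = q u u + t * q v u" "q ?w v = q u v + t * q v v"
      using u v w by (simp_all add: add_left scale_left)
    moreover have "q ?w ?w = q ?w u + t * q ?w v"
      using add_left[OF u w(2) w(1)] scale_left[OF v w(1), of t] commute[OF w(1)] u v by simp
    ultimately have "q ?w ?w = q u u + 2 * t * q u v + t\<^sup>2 * q v v"
      using commute[OF u v] by (simp add: algebra_simps power2_eq_square)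
    then show ?thesis using nonneg[OF w(1)] by simp
  qed
  have "(q u v)\<^sup>2 \<le> q u u * q v v"
  proof (cases "q v v = 0")
    case True
    have "q u v = 0"
    proof (rule ccontr)
      assume "q u v \<noteq> 0"
      then show False
        \<comment> \<open>this \<open>t\<close> gives the linear polynomial \<open>q u u + 2 * t * q u v\<close> the value -1\<close>
        using expand[of "- (q u u + 1) / (2 * q u v)"] True by (simp add: field_simps)
    qed
    then show ?thesis using True by simp
  next
    case False
    then have "q v v > 0" using nonneg[OF v] by simp
    then show ?thesis
      \<comment> \<open>the minimum of the quadratic polynomial\<close>
      using expand[of "- q u v / q v v"] by (simp add: field_simps power2_eq_square)
  qed
  then have "\<bar>q u v\<bar> \<le> sqrt (q u u * q v v)"
    by (rule real_le_rsqrt[of "\<bar>q u v\<bar>", simplified])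
  then show ?thesis by (simp add: real_sqrt_mult)
qed

text \<open>
  Parseval's identity for the vector \<open>u\<close> and the family \<open>Q\<close>. Unlike an expansion of \<open>u\<close> itself, it
  is meaningful for a degenerate form, and it is linear in \<open>u\<close>.
\<close>

definition reproduces :: "('a \<Rightarrow> 'b) set \<Rightarrow> ('a \<Rightarrow> 'b) \<Rightarrow> bool" where
  "reproduces Q u \<longleftrightarrow> (\<forall>v\<in>V. q u v = (\<Sum>e\<in>Q. q u e * q e v))"

lemma reproduces_lincomb:
  assumes "finite I" "\<And>i. i \<in> I \<Longrightarrow> f i \<in> V" "\<And>i. i \<in> I \<Longrightarrow> reproduces Q (f i)" "Q \<subseteq> V"
  shows "reproduces Q (\<lambda>x. \<Sum>i\<in>I. c i *\<^sub>R f i x)"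
  unfolding reproduces_def
proof
  fix v assume v: "v \<in> V"
  have "q (\<lambda>x. \<Sum>i\<in>I. c i *\<^sub>R f i x) v = (\<Sum>i\<in>I. c i * (\<Sum>e\<in>Q. q (f i) e * q e v))"
    using assms v by (simp add: sum_left reproduces_def)
  also have "\<dots> = (\<Sum>e\<in>Q. (\<Sum>i\<in>I. c i * q (f i) e) * q e v)"
    by (subst sum_distrib_left, subst sum.swap) (simp add: sum_distrib_right mult.assoc)
  also have "\<dots> = (\<Sum>e\<in>Q. q (\<lambda>x. \<Sum>i\<in>I. c i *\<^sub>R f i x) e * q e v)"
    using assms by (intro sum.cong) (auto simp: sum_left)
  finally show "q (\<lambda>x. \<Sum>i\<in>I. c i *\<^sub>R f i x) v = (\<Sum>e\<in>Q. q (\<lambda>x. \<Sum>i\<in>I. c i *\<^sub>R f i x) e * q e v)" .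
qed

text \<open>
  The residue \<open>r\<close> of a new vector is orthogonal to \<open>Q\<close>, because \<open>Q\<close> reproduces its own members;
  this is what the induction uses in place of orthonormality. If \<open>q r r = 0\<close> then \<open>r\<close> is in the
  kernel of \<open>q\<close> and \<open>Q\<close> already reproduces the new vector; otherwise the normalised residue is
  added to \<open>Q\<close>.
\<close>

lemma Gram_Schmidt:
  assumes "finite S" "S \<subseteq> V"
  shows "\<exists>Q. finite Q \<and> Q \<subseteq> V \<and> (\<forall>s\<in>S \<union> Q. reproduces Q s)"
  using assms
proof (induction S rule: finite_induct)
  case empty
  show ?case by (rule exI[of _ "{}"]) simp
next
  case (insert s S)
  then obtain Q where Q: "finite Q" "Q \<subseteq> V" "\<And>t. t \<in> S \<union> Q \<Longrightarrow> reproduces Q t" by auto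
  have s: "s \<in> V" using insert.prems by simp
  define p where "p = (\<lambda>x. \<Sum>e\<in>Q. q s e *\<^sub>R e x)"
  define r where "r = (\<lambda>x. s x - p x)"
  have p: "p \<in> V" unfolding p_def using Q by (intro sum_mem) auto
  have r: "r \<in> V" unfolding r_def using s p by (rule diff_mem)
  have qp: "q p v = (\<Sum>e\<in>Q. q s e * q e v)" if "v \<in> V" for v
    unfolding p_def using Q that by (intro sum_left) auto
  have qs: "q s v = q r v + (\<Sum>e\<in>Q. q s e * q e v)" if "v \<in> V" for v
    unfolding r_def using diff_left[OF s p that] qp[OF that] by simp
  have orth: "q r e = 0" if e: "e \<in> Q" for e
  proof -
    have "e \<in> V" using Q e by auto
    have "q s e = q e s" using s \<open>e \<in> V\<close> by (rule commute)
    also have "\<dots> = (\<Sum>e'\<in>Q. q e e' * q e' s)"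
      using Q(3)[of e] e s by (simp add: reproduces_def)
    also have "\<dots> = (\<Sum>e'\<in>Q. q s e' * q e' e)"
      using Q(2) s \<open>e \<in> V\<close> commute by (intro sum.cong) (auto simp: mult.commute subset_iff)
    finally show ?thesis using qs[OF \<open>e \<in> V\<close>] by simp
  qed
  show ?case
  proof (cases "q r r = 0")
    case True
    then have "q r v = 0" if "v \<in> V" for v
      using Cauchy_Schwarz[OF r that] by simp
    then have "reproduces Q s" using qs by (simp add: reproduces_def)
    then show ?thesis using Q by (intro exI[of _ Q]) auto
  next
    case False
    define c where "c = 1 / sqrt (q r r)"
    define o' where "o' = (\<lambda>x. c *\<^sub>R r x)"
    have o': "o' \<in> V" unfolding o'_def using r by (rule scale_mem)
    have pos: "q r r > 0" using False nonneg[OF r] by simp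
    have qo: "q o' v = c * q r v" if "v \<in> V" for v
      unfolding o'_def using r that by (rule scale_left)
    have cc: "c * (c * q r r) = 1" using pos by (simp add: c_def field_simps)
    have oo: "q o' o' = 1" using qo[OF o'] qo[OF r] commute[OF r o'] cc by simp
    have orth': "q o' e = 0" "q e o' = 0" if "e \<in> Q" for e
      using orth[OF that] qo[of e] commute[of e o'] o' Q(2) that by auto
    have notin: "o' \<notin> Q" using orth'(1)[of o'] oo by auto
    have ro: "q r o' = c * q r r" using qo[OF r] commute[OF r o'] by simp
    have old: "reproduces (insert o' Q) t" if t: "t \<in> S \<union> Q" for t
    proof -
      have "q t o' = (\<Sum>e\<in>Q. q t e * q e o')"
        using Q(3)[OF t] o' by (simp add: reproduces_def)
      then have "q t o' = 0" using orth' by simp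
      then show ?thesis using Q(1) Q(3)[OF t] notin by (simp add: reproduces_def)
    qed
    moreover have "reproduces (insert o' Q) o'"
      using Q(1) notin oo orth' by (simp add: reproduces_def)
    moreover have "reproduces (insert o' Q) s"
    proof -
      have "q s o' = c * q r r" using qs[OF o'] orth' ro by simp
      then have "q s o' * q o' v = q r v" if "v \<in> V" for v
        using qo[OF that] cc by (simp add: algebra_simps)
      then show ?thesis using Q(1) notin qs by (simp add: reproduces_def)
    qed
    ultimately show ?thesis
      using Q(1,2) o' by (intro exI[of _ "insert o' Q"]) auto
  qed
qed

end

section \<open>Uniqueness of weak derivatives\<close>

lemma L2_zero: "(\<lambda>x. 0) \<in> L2 \<Omega>"
  by (simp add: L2_def)

interpretation L2: semi_inner_product_space "L2 \<Omega>" "L2_inner \<Omega>"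
  by unfold_locales
     (auto intro: L2_zero L2_add L2_scale L2_inner_add_left L2_inner_scale_left L2_inner_commute L2_inner_nonneg)

lemma lebesgue_on_finite_measure:
  fixes \<Omega> :: "(real^3) set"
  assumes "open \<Omega>" "bounded \<Omega>"
  shows "finite_measure (lebesgue_on \<Omega>)"
  using assms by (simp add: finite_measure_lebesgue_on lmeasurable_open)

lemma continuous_in_L2:
  fixes f :: "real^3 \<Rightarrow> 'b::euclidean_space"
  assumes \<Omega>: "open \<Omega>" "bounded \<Omega>" and f: "continuous_on UNIV f"
  shows "f \<in> L2 \<Omega>"
proof -
  interpret finite_measure "lebesgue_on \<Omega>" using \<Omega> by (rule lebesgue_on_finite_measure)
  have "f \<in> borel_measurable borel" using f by (rule borel_measurable_continuous_onI)
  then have [measurable]: "f \<in> borel_measurable (lebesgue_on \<Omega>)"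
    by (intro measurable_restrict_space1) (simp add: measurable_completion)
  have "compact (f ` closure \<Omega>)"
    using \<Omega> f by (intro compact_continuous_image) (auto intro: continuous_on_subset)
  then obtain K where K: "\<And>x. x \<in> \<Omega> \<Longrightarrow> norm (f x) \<le> K"
    using closure_subset by (fastforce dest: compact_imp_bounded simp: bounded_iff)
  have "integrable (lebesgue_on \<Omega>) (\<lambda>x. (norm (f x))\<^sup>2)"
    by (rule integrable_const_bound[of _ "K\<^sup>2"]) (auto intro!: AE_I2 power_mono K)
  then show ?thesis by (simp add: L2_def)
qed

text \<open>
  Testing with scalar test functions times a basis vector reduces the claim to the scalar
  fundamental lemma for the components of \<open>u - v\<close>.
\<close>

lemma L2_eq_if_weakly_equal:
  fixes u v :: "real^3 \<Rightarrow> 'b::euclidean_space"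
  assumes \<Omega>: "open \<Omega>" "bounded \<Omega>" and u: "u \<in> L2 \<Omega>" and v: "v \<in> L2 \<Omega>"
    and test: "\<And>\<psi>. test_function \<Omega> \<psi> \<Longrightarrow> L2_inner \<Omega> u \<psi> = L2_inner \<Omega> v \<psi>"
  shows "L2_eq \<Omega> u v"
proof -
  define d where "d = (\<lambda>x. u x - v x)"
  have d: "d \<in> L2 \<Omega>" unfolding d_def using u v by (rule L2.diff_mem)
  have "AE x in lebesgue_on \<Omega>. d x \<bullet> e = 0" for e
  proof (rule fundamental_lemma_of_calculus_of_variations[OF _ \<Omega>(1)])
    show "integrable (lebesgue_on \<Omega>) (\<lambda>x. d x \<bullet> e)"
      using d continuous_in_L2[OF \<Omega>, of "\<lambda>x. e"] by (intro L2_integrable_inner) auto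
    fix \<psi> :: "real^3 \<Rightarrow> real" assume "test_function \<Omega> \<psi>"
    then have \<psi>: "test_function \<Omega> (\<lambda>x. \<psi> x *\<^sub>R e)" by (rule test_function_scaleR_const)
    then have "continuous_on UNIV (\<lambda>x. \<psi> x *\<^sub>R e)"
      unfolding test_function_def smooth_def
      by (metis continuous_on_eq_continuous_at differentiable_imp_continuous_within foldr.simps(1) id_apply open_UNIV)
    then have "L2_inner \<Omega> d (\<lambda>x. \<psi> x *\<^sub>R e) = 0"
      unfolding d_def using test[OF \<psi>] L2.diff_left[OF u v continuous_in_L2[OF \<Omega>]] by simp
    then show "(\<integral>x. d x \<bullet> e * \<psi> x \<partial>lebesgue_on \<Omega>) = 0"
      by (simp add: L2_inner_def mult.commute)
  qed
  then have "AE x in lebesgue_on \<Omega>. \<forall>e\<in>Basis. d x \<bullet> e = 0"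
    by (subst AE_finite_all) auto
  then show ?thesis
    unfolding L2_eq_def d_def by eventually_elim (auto intro: euclidean_eqI simp: inner_simps)
qed

lemma smooth_continuous:
  assumes "smooth f"
  shows "continuous_on UNIV f"
proof -
  have "f differentiable (at x)" for x
    using assms[unfolded smooth_def, rule_format, of "[]" x] by simp
  then show ?thesis
    by (simp add: continuous_on_eq_continuous_at differentiable_imp_continuous_within)
qed

lemma smooth_continuous_partial:
  assumes "smooth f"
  shows "continuous_on UNIV (partial i f)"
proof -
  have "partial i f differentiable (at x)" for x
    using assms[unfolded smooth_def, rule_format, of "[i]" x] by simp
  then show ?thesis
    by (simp add: continuous_on_eq_continuous_at differentiable_imp_continuous_within)
qed

lemma test_function_in_L2:
  assumes "open \<Omega>" "bounded \<Omega>" "test_function \<Omega> \<psi>"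
  shows "\<psi> \<in> L2 \<Omega>"
  using assms by (intro continuous_in_L2 smooth_continuous) (simp_all add: test_function_def)

lemma curl_test_function_in_L2:
  assumes "open \<Omega>" "bounded \<Omega>" "test_function \<Omega> \<psi>"
  shows "curl \<psi> \<in> L2 \<Omega>"
proof (intro continuous_in_L2 assms(1,2))
  note [continuous_intros] = smooth_continuous_partial[OF assms(3)[unfolded test_function_def, THEN conjunct1]]
  have "continuous_on UNIV (\<lambda>x. curl \<psi> x $ i)" for i
    using exhaust_3[of i] by (elim disjE; simp add: curl_def; intro continuous_intros)
  then have "continuous_on UNIV (\<lambda>x. \<chi> i. curl \<psi> x $ i)"
    by (rule continuous_on_vec_lambda)
  then show "continuous_on UNIV (curl \<psi>)"
    by simp
qed

lemma grad_test_function_in_L2: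
  assumes "open \<Omega>" "bounded \<Omega>" "test_function \<Omega> \<psi>"
  shows "grad \<psi> \<in> L2 \<Omega>"
  unfolding grad_def[abs_def] using assms
  by (intro continuous_in_L2 continuous_on_vec_lambda smooth_continuous_partial)
     (simp_all add: test_function_def)

lemma L2_eq_sym: "L2_eq \<Omega> u v \<Longrightarrow> L2_eq \<Omega> v u"
  unfolding L2_eq_def by (simp add: eq_commute)

lemma has_weak_curl_unique:
  assumes "open \<Omega>" "bounded \<Omega>" "has_weak_curl \<Omega> u w" "has_weak_curl \<Omega> u w'"
  shows "L2_eq \<Omega> w w'"
  using assms by (intro L2_eq_if_weakly_equal) (auto simp: has_weak_curl_def)

lemma has_weak_grad_unique:
  assumes "open \<Omega>" "bounded \<Omega>" "has_weak_grad \<Omega> \<phi> g" "has_weak_grad \<Omega> \<phi> g'"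
  shows "L2_eq \<Omega> g g'"
  using assms by (intro L2_eq_if_weakly_equal) (auto simp: has_weak_grad_def)

lemma has_weak_curl_weak_curl: "u \<in> H_curl \<Omega> \<Longrightarrow> has_weak_curl \<Omega> u (weak_curl \<Omega> u)"
  unfolding weak_curl_def H_curl_def using someI_ex[of "has_weak_curl \<Omega> u"] by blast

lemma has_weak_div_weak_div: "u \<in> H_div \<Omega> \<Longrightarrow> has_weak_div \<Omega> u (weak_div \<Omega> u)"
  unfolding weak_div_def H_div_def using someI_ex[of "has_weak_div \<Omega> u"] by blast

lemma weak_curl_in_L2: "u \<in> H_curl \<Omega> \<Longrightarrow> weak_curl \<Omega> u \<in> L2 \<Omega>"
  using has_weak_curl_weak_curl by (auto simp: has_weak_curl_def)

lemma H_curl_in_L2: "u \<in> H_curl \<Omega> \<Longrightarrow> u \<in> L2 \<Omega>"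
  by (auto simp: H_curl_def has_weak_curl_def)

lemma weak_curl_eqI:
  assumes "open \<Omega>" "bounded \<Omega>" "has_weak_curl \<Omega> u w"
  shows "L2_eq \<Omega> (weak_curl \<Omega> u) w"
  using assms has_weak_curl_weak_curl[of u \<Omega>]
  by (intro has_weak_curl_unique[of \<Omega> u]) (auto simp: H_curl_def)

section \<open>The weak curl as a linear operator\<close>

lemma has_weak_curl_add:
  assumes \<Omega>: "open \<Omega>" "bounded \<Omega>" and u: "has_weak_curl \<Omega> u w" and u': "has_weak_curl \<Omega> u' w'"
  shows "has_weak_curl \<Omega> (\<lambda>x. u x + u' x) (\<lambda>x. w x + w' x)"
  unfolding has_weak_curl_def
proof (intro conjI allI impI)
  fix \<psi> :: "real^3 \<Rightarrow> real^3" assume \<psi>: "test_function \<Omega> \<psi>"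
  show "L2_inner \<Omega> (\<lambda>x. w x + w' x) \<psi> = L2_inner \<Omega> (\<lambda>x. u x + u' x) (curl \<psi>)"
    using u u' \<psi> test_function_in_L2[OF \<Omega> \<psi>] curl_test_function_in_L2[OF \<Omega> \<psi>]
    by (simp add: has_weak_curl_def L2_inner_add_left)
qed (use u u' in \<open>auto simp: has_weak_curl_def intro: L2_add\<close>)

lemma has_weak_curl_scale:
  assumes "has_weak_curl \<Omega> u w"
  shows "has_weak_curl \<Omega> (\<lambda>x. c *\<^sub>R u x) (\<lambda>x. c *\<^sub>R w x)"
  using assms by (auto simp: has_weak_curl_def L2_inner_scale_left intro: L2_scale)

lemma has_weak_curl_cong:
  assumes \<Omega>: "open \<Omega>" "bounded \<Omega>" and u: "has_weak_curl \<Omega> u w" and eq: "L2_eq \<Omega> u u'" "u' \<in> L2 \<Omega>"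
  shows "has_weak_curl \<Omega> u' w"
  using assms by (auto simp: has_weak_curl_def L2_inner_cong[OF eq(1) _ eq(2) curl_test_function_in_L2[OF \<Omega>]])

lemma L2_subspace_diff:
  assumes V: "L2_subspace \<Omega> V" and u: "u \<in> V" and v: "v \<in> V"
  shows "(\<lambda>x. u x - v x) \<in> V"
proof -
  have add: "\<And>u v. u \<in> V \<Longrightarrow> v \<in> V \<Longrightarrow> (\<lambda>x. u x + v x) \<in> V"
    and scale: "\<And>u c. u \<in> V \<Longrightarrow> (\<lambda>x. c *\<^sub>R u x) \<in> V"
    using V by (auto simp: L2_subspace_def)
  show ?thesis using add[OF u scale[OF v, of "-1"]] by simp
qed

text \<open>
  Bilinearity holds exactly, although \<open>weak_curl\<close> is linear only almost everywhere.
\<close>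

lemma weak_curl_semi_inner_product:
  assumes \<Omega>: "open \<Omega>" "bounded \<Omega>" and V: "L2_subspace \<Omega> V" "V \<subseteq> H_curl \<Omega>"
  shows "semi_inner_product_space V (\<lambda>u v. L2_inner \<Omega> (weak_curl \<Omega> u) (weak_curl \<Omega> v))"
proof
  note L2 = weak_curl_in_L2[OF subsetD[OF V(2)]]
  note curl = has_weak_curl_weak_curl[OF subsetD[OF V(2)]]
  show "(\<lambda>x. 0) \<in> V" using V(1) by (simp add: L2_subspace_def)
  show sV: "(\<lambda>x. c *\<^sub>R u x) \<in> V" if "u \<in> V" for u c using V(1) that by (simp add: L2_subspace_def)
  show aV: "(\<lambda>x. u x + v x) \<in> V" if "u \<in> V" "v \<in> V" for u v using V(1) that by (simp add: L2_subspace_def)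
  show "L2_inner \<Omega> (weak_curl \<Omega> (\<lambda>x. u x + v x)) (weak_curl \<Omega> w) =
        L2_inner \<Omega> (weak_curl \<Omega> u) (weak_curl \<Omega> w) + L2_inner \<Omega> (weak_curl \<Omega> v) (weak_curl \<Omega> w)"
    if "u \<in> V" "v \<in> V" "w \<in> V" for u v w
  proof -
    have "L2_eq \<Omega> (weak_curl \<Omega> (\<lambda>x. u x + v x)) (\<lambda>x. weak_curl \<Omega> u x + weak_curl \<Omega> v x)"
      using that by (intro weak_curl_eqI[OF \<Omega>] has_weak_curl_add[OF \<Omega>] curl)
    then have "L2_inner \<Omega> (weak_curl \<Omega> (\<lambda>x. u x + v x)) (weak_curl \<Omega> w) =
          L2_inner \<Omega> (\<lambda>x. weak_curl \<Omega> u x + weak_curl \<Omega> v x) (weak_curl \<Omega> w)"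
      using that by (intro L2_inner_cong L2_add L2 aV)
    then show ?thesis using L2_inner_add_left[OF L2 L2 L2] that by simp
  qed
  show "L2_inner \<Omega> (weak_curl \<Omega> (\<lambda>x. c *\<^sub>R u x)) (weak_curl \<Omega> w) =
        c * L2_inner \<Omega> (weak_curl \<Omega> u) (weak_curl \<Omega> w)"
    if "u \<in> V" "w \<in> V" for u w c
  proof -
    have "L2_eq \<Omega> (weak_curl \<Omega> (\<lambda>x. c *\<^sub>R u x)) (\<lambda>x. c *\<^sub>R weak_curl \<Omega> u x)"
      using that by (intro weak_curl_eqI[OF \<Omega>] has_weak_curl_scale curl)
    then have "L2_inner \<Omega> (weak_curl \<Omega> (\<lambda>x. c *\<^sub>R u x)) (weak_curl \<Omega> w) =
          L2_inner \<Omega> (\<lambda>x. c *\<^sub>R weak_curl \<Omega> u x) (weak_curl \<Omega> w)"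
      using that by (intro L2_inner_cong L2_scale L2 sV)
    then show ?thesis by (simp add: L2_inner_scale_left)
  qed
qed (simp_all add: L2_inner_commute L2_inner_nonneg)

section \<open>Orthogonality of gradients and curls\<close>

text \<open>
  Gradients of test functions are orthogonal to \<open>w\<close> by the definition of the weak divergence, and the
  gradient of \<open>\<phi>\<close> is an \<open>L\<^sup>2\<close> limit of such gradients. The limit in the definition of \<open>H0_1\<close> need
  not be the chosen representative \<open>weak_grad \<Omega> \<phi>\<close>; uniqueness of weak gradients identifies the two.
\<close>

lemma H0_1_gradient_orthogonal_to_divergence_free:
  assumes \<Omega>: "open \<Omega>" "bounded \<Omega>" and \<phi>: "\<phi> \<in> H0_1 \<Omega>" and w: "has_weak_div \<Omega> w d"
    and d: "L2_eq \<Omega> d (\<lambda>x. 0)"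
  shows "L2_inner \<Omega> (weak_grad \<Omega> \<phi>) w = 0"
proof -
  obtain g \<psi> where g: "has_weak_grad \<Omega> \<phi> g" and \<psi>: "\<And>k::nat. test_function \<Omega> (\<psi> k)"
    and lim: "(\<lambda>k. L2_norm \<Omega> (\<lambda>x. grad (\<psi> k) x - g x)) \<longlonglongrightarrow> 0"
    using \<phi> unfolding H0_1_def by blast
  have wg: "has_weak_grad \<Omega> \<phi> (weak_grad \<Omega> \<phi>)"
    unfolding weak_grad_def using someI[of "has_weak_grad \<Omega> \<phi>", OF g] .
  have L2: "g \<in> L2 \<Omega>" "weak_grad \<Omega> \<phi> \<in> L2 \<Omega>" "w \<in> L2 \<Omega>" "d \<in> L2 \<Omega>"
    using g wg w by (auto simp: has_weak_grad_def has_weak_div_def)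
  have gL2: "grad (\<psi> k) \<in> L2 \<Omega>" for k using \<Omega> \<psi> by (rule grad_test_function_in_L2)
  have grad0: "L2_inner \<Omega> (grad (\<psi> k)) w = 0" for k
  proof -
    have "L2_inner \<Omega> d (\<psi> k) = 0"
      using L2_inner_cong[OF d L2(4) L2_zero test_function_in_L2[OF \<Omega> \<psi>]]
      by (simp add: L2_inner_def)
    then show ?thesis
      using w \<psi>[of k] by (simp add: has_weak_div_def L2_inner_commute[of \<Omega> "grad (\<psi> k)"])
  qed
  have bound: "\<bar>L2_inner \<Omega> g w\<bar> \<le> L2_norm \<Omega> (\<lambda>x. grad (\<psi> k) x - g x) * L2_norm \<Omega> w" for k
    using L2.Cauchy_Schwarz[OF L2.diff_mem[OF gL2[of k] L2(1)] L2(3)]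
      L2.diff_left[OF gL2[of k] L2(1) L2(3)] grad0 by (simp add: L2_norm_def)
  have "(\<lambda>k. L2_norm \<Omega> (\<lambda>x. grad (\<psi> k) x - g x) * L2_norm \<Omega> w) \<longlonglongrightarrow> 0"
    using tendsto_mult_right[OF lim, of "L2_norm \<Omega> w"] by simp
  then have "\<bar>L2_inner \<Omega> g w\<bar> \<le> 0"
    by (rule LIMSEQ_le_const) (use bound in auto)
  then show ?thesis
    using L2_inner_cong[OF has_weak_grad_unique[OF \<Omega> wg g]] L2 by simp
qed

text \<open>
  Exactness enters twice: \<open>z\<close> is a gradient by exactness at \<open>V1\<close>, and \<open>curl u\<close> is divergence free by
  exactness at \<open>V2\<close>.
\<close>

lemma curl_free_orthogonal_to_curls:
  assumes \<Omega>: "open \<Omega>" "bounded \<Omega>"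
    and complex: "de_rham_subcomplex \<Omega> V0 V1 V2 V3" and exact: "exact_complex \<Omega> V0 V1 V2 V3"
    and z: "z \<in> V1" "L2_eq \<Omega> (weak_curl \<Omega> z) (\<lambda>x. 0)" and u: "u \<in> V1"
  shows "L2_inner \<Omega> z (weak_curl \<Omega> u) = 0"
proof -
  have V: "V0 \<subseteq> H0_1 \<Omega>" "V1 \<subseteq> H_curl \<Omega>" "V2 \<subseteq> H_div \<Omega>" "weak_grad \<Omega> ` V0 \<subseteq> V1" "weak_curl \<Omega> ` V1 \<subseteq> V2"
    using complex by (auto simp: de_rham_subcomplex_def H0_curl_def H0_div_def)
  obtain \<phi> where \<phi>: "\<phi> \<in> V0" "L2_eq \<Omega> (weak_grad \<Omega> \<phi>) z"
    using exact z by (auto simp: exact_complex_def)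
  have c: "weak_curl \<Omega> u \<in> V2" using u V by auto
  have "L2_eq \<Omega> (weak_div \<Omega> (weak_curl \<Omega> u)) (\<lambda>x. 0)"
    using exact c u by (auto simp: exact_complex_def L2_eq_def)
  then have "L2_inner \<Omega> (weak_grad \<Omega> \<phi>) (weak_curl \<Omega> u) = 0"
    using H0_1_gradient_orthogonal_to_divergence_free[OF \<Omega> _ has_weak_div_weak_div] \<phi>(1) c V by blast
  moreover have "weak_grad \<Omega> \<phi> \<in> L2 \<Omega>" "z \<in> L2 \<Omega>" "weak_curl \<Omega> u \<in> L2 \<Omega>"
    using H_curl_in_L2 weak_curl_in_L2 V \<phi>(1) z(1) u by blast+
  ultimately show ?thesis using L2_inner_cong[OF \<phi>(2)] by simp
qed

section \<open>The Arnold inequality\<close>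

text \<open>
  Helicity does not see the curl-free part \<open>z\<close> of \<open>u\<close>, and the remainder \<open>p\<close> is controlled by
  \<open>\<parallel>curl u\<parallel>\<close> through its coefficients \<open>q u e\<close>.
\<close>

lemma discrete_Arnold_inequality:
  assumes \<Omega>: "open \<Omega>" "bounded \<Omega>"
    and V1: "L2_subspace \<Omega> V1" "L2_finite_dim \<Omega> V1"
    and complex: "de_rham_subcomplex \<Omega> V0 V1 V2 V3" and exact: "exact_complex \<Omega> V0 V1 V2 V3"
  shows "\<exists>C\<ge>0. \<forall>u\<in>V1. \<bar>L2_inner \<Omega> u (weak_curl \<Omega> u)\<bar>
            \<le> C * L2_inner \<Omega> (weak_curl \<Omega> u) (weak_curl \<Omega> u)"
proof -
  have H: "V1 \<subseteq> H_curl \<Omega>"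
    using complex by (auto simp: de_rham_subcomplex_def H0_curl_def)
  define q where "q u v = L2_inner \<Omega> (weak_curl \<Omega> u) (weak_curl \<Omega> v)" for u v
  interpret q: semi_inner_product_space V1 q
    unfolding q_def[abs_def] by (rule weak_curl_semi_inner_product[OF \<Omega> V1(1) H])
  note L2 = H_curl_in_L2[OF subsetD[OF H]] and cL2 = weak_curl_in_L2[OF subsetD[OF H]]
  obtain S where S: "finite S" "S \<subseteq> V1" "\<And>u. u \<in> V1 \<Longrightarrow> \<exists>c. L2_eq \<Omega> u (\<lambda>x. \<Sum>b\<in>S. c b *\<^sub>R b x)"
    using V1(2) by (auto simp: L2_finite_dim_def)
  obtain Q where Q: "finite Q" "Q \<subseteq> V1" "\<And>s. s \<in> S \<Longrightarrow> q.reproduces Q s"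
    using q.Gram_Schmidt[OF S(1,2)] by blast
  have repr: "q u v = (\<Sum>e\<in>Q. q u e * q e v)" if u: "u \<in> V1" and v: "v \<in> V1" for u v
  proof -
    obtain c where c: "L2_eq \<Omega> u (\<lambda>x. \<Sum>b\<in>S. c b *\<^sub>R b x)" using S(3)[OF u] by blast
    define s where "s = (\<lambda>x. \<Sum>b\<in>S. c b *\<^sub>R b x)"
    have s: "s \<in> V1" unfolding s_def using S by (intro q.sum_mem[where f = "\<lambda>b. b"]) auto
    have "L2_eq \<Omega> (weak_curl \<Omega> u) (weak_curl \<Omega> s)"
      using c[folded s_def, THEN L2_eq_sym] H s u L2[OF u]
      by (intro weak_curl_eqI[OF \<Omega>] has_weak_curl_cong[OF \<Omega> has_weak_curl_weak_curl]) auto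
    then have eq: "q u w = q s w" if "w \<in> V1" for w
      unfolding q_def using cL2 u s that by (intro L2_inner_cong) auto
    have "q.reproduces Q s"
      unfolding s_def using S Q by (intro q.reproduces_lincomb[where f = "\<lambda>b. b"]) auto
    then have "q s v = (\<Sum>e\<in>Q. q s e * q e v)" using v by (simp add: q.reproduces_def)
    then show ?thesis using eq v Q(2) by (simp add: subset_iff)
  qed
  define C where "C = (\<Sum>e\<in>Q. sqrt (q e e) * L2_norm \<Omega> e)"
  have "\<bar>L2_inner \<Omega> u (weak_curl \<Omega> u)\<bar> \<le> C * q u u" if u: "u \<in> V1" for u
  proof -
    define p where "p = (\<lambda>x. \<Sum>e\<in>Q. q u e *\<^sub>R e x)"
    define z where "z = (\<lambda>x. u x - p x)"
    have p: "p \<in> V1" unfolding p_def using Q by (intro q.sum_mem) auto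
    have z: "z \<in> V1" unfolding z_def using u p by (rule q.diff_mem)
    have "q z z = q u z - q p z" unfolding z_def using q.diff_left[OF u p z[unfolded z_def]] .
    also have "q p z = (\<Sum>e\<in>Q. q u e * q e z)"
      unfolding p_def using Q z by (intro q.sum_left) auto
    finally have "q z z = 0" using repr[OF u z] by simp
    then have "L2_eq \<Omega> (weak_curl \<Omega> z) (\<lambda>x. 0)"
      unfolding q_def using L2_eq_0_iff[OF cL2[OF z]] by simp
    then have "L2_inner \<Omega> z (weak_curl \<Omega> u) = 0"
      by (rule curl_free_orthogonal_to_curls[OF \<Omega> complex exact z _ u])
    then have "L2_inner \<Omega> u (weak_curl \<Omega> u) = L2_inner \<Omega> p (weak_curl \<Omega> u)"
      using L2.diff_left[OF L2[OF u] L2[OF p] cL2[OF u]] by (simp add: z_def)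
    also have "\<dots> = (\<Sum>e\<in>Q. q u e * L2_inner \<Omega> e (weak_curl \<Omega> u))"
      unfolding p_def using Q L2 cL2[OF u] by (intro L2.sum_left) auto
    finally have "\<bar>L2_inner \<Omega> u (weak_curl \<Omega> u)\<bar> \<le> (\<Sum>e\<in>Q. \<bar>q u e * L2_inner \<Omega> e (weak_curl \<Omega> u)\<bar>)"
      by simp
    also have "\<dots> \<le> (\<Sum>e\<in>Q. sqrt (q e e) * L2_norm \<Omega> e * q u u)"
    proof (rule sum_mono)
      fix e assume "e \<in> Q"
      then have e: "e \<in> V1" using Q by auto
      have "\<bar>L2_inner \<Omega> e (weak_curl \<Omega> u)\<bar> \<le> L2_norm \<Omega> e * sqrt (q u u)"
        using L2.Cauchy_Schwarz[OF L2[OF e] cL2[OF u]] by (simp add: L2_norm_def q_def)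
      then have "\<bar>q u e * L2_inner \<Omega> e (weak_curl \<Omega> u)\<bar>
          \<le> (sqrt (q u u) * sqrt (q e e)) * (L2_norm \<Omega> e * sqrt (q u u))"
        unfolding abs_mult using q.Cauchy_Schwarz[OF u e] q.nonneg[OF u] q.nonneg[OF e]
        by (intro mult_mono) auto
      also have "\<dots> = sqrt (q e e) * L2_norm \<Omega> e * q u u"
        using q.nonneg[OF u] by simp
      finally show "\<bar>q u e * L2_inner \<Omega> e (weak_curl \<Omega> u)\<bar> \<le> sqrt (q e e) * L2_norm \<Omega> e * q u u" .
    qed
    finally show ?thesis by (simp add: C_def sum_distrib_right)
  qed
  moreover have "C \<ge> 0"
    unfolding C_def using Q(2) q.nonneg L2_inner_nonneg
    by (intro sum_nonneg mult_nonneg_nonneg) (auto simp: L2_norm_def)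
  ultimately show ?thesis unfolding q_def by blast
qed

section \<open>Conservation laws of the scheme\<close>

theorem theorem5p4:
  fixes \<Omega> :: "(real^3) set"
    and T :: "(real^3) set set"
    and V0 V3 :: "(real^3 \<Rightarrow> real) set"
    and V1 V2 :: "(real^3 \<Rightarrow> real^3) set"
    and dt \<tau> :: real
    and B A E j :: "nat \<Rightarrow> real^3 \<Rightarrow> real^3"
    and lamE lamH :: "nat \<Rightarrow> real"
  assumes dom: "bounded \<Omega>" "contractible \<Omega>" "lipschitz_domain \<Omega>"
    and mesh: "mesh \<Omega> T"
    and fe: "fe_space \<Omega> T V0" "fe_space \<Omega> T V1" "fe_space \<Omega> T V2" "fe_space \<Omega> T V3"
    and complex: "de_rham_subcomplex \<Omega> V0 V1 V2 V3"
    and exact: "exact_complex \<Omega> V0 V1 V2 V3"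
    and pos: "dt > 0" "\<tau> > 0"
    and init: "B 0 \<in> V2" "A 0 \<in> V1"
    and spaces: "\<And>n. B (Suc n) \<in> V2" "\<And>n. A (Suc n) \<in> V1"
      "\<And>n. E (Suc n) \<in> V1" "\<And>n. j (Suc n) \<in> V1"
    and eq_A: "\<And>n D. D \<in> V1 \<Longrightarrow>
        L2_inner \<Omega> (\<lambda>x. (A (Suc n) x - A n x) /\<^sub>R dt) D
        + L2_inner \<Omega> (E (Suc n)) D
        + lamH (Suc n) * L2_inner \<Omega> (B (Suc n)) D
        + lamE (Suc n) * L2_inner \<Omega> (j (Suc n)) D = 0"
    and eq_B: "\<And>n C. C \<in> V2 \<Longrightarrow>
        L2_inner \<Omega> (B (Suc n)) C - L2_inner \<Omega> (weak_curl \<Omega> (A (Suc n))) C = 0"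
    and eq_E: "\<And>n F. F \<in> V1 \<Longrightarrow>
        L2_inner \<Omega> (E (Suc n)) F
        + \<tau> * L2_inner \<Omega> (\<lambda>x. cross3 (cross3 (j (Suc n) x) (B (Suc n) x)) (B (Suc n) x)) F = 0"
    and eq_j: "\<And>n k. k \<in> V1 \<Longrightarrow>
        L2_inner \<Omega> (j (Suc n)) k - L2_inner \<Omega> (B (Suc n)) (weak_curl \<Omega> k) = 0"
    and eq_energy: "\<And>n. (energy \<Omega> B (Suc n) - energy \<Omega> B n) / dt
        + 2 * \<tau> * (L2_norm \<Omega> (\<lambda>x. cross3 (B (Suc n) x) (j (Suc n) x)))\<^sup>2 = 0"
    and eq_helicity: "\<And>n. helicity \<Omega> A B (Suc n) - helicity \<Omega> A B n = 0"
  shows "(\<forall>n. energy \<Omega> B (Suc n) \<le> energy \<Omega> B n) \<and> decseq (energy \<Omega> B) \<and>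
         (\<forall>n. L2_eq \<Omega> (weak_div \<Omega> (B (Suc n))) (\<lambda>x. 0)) \<and>
         (\<forall>n. helicity \<Omega> A B (Suc n) = helicity \<Omega> A B n \<and>
              helicity \<Omega> A B n = helicity \<Omega> A B 0) \<and>
         (\<exists>C>0. \<forall>n. \<bar>helicity \<Omega> A B n\<bar> \<le> C * energy \<Omega> B n)"
proof -
  have \<Omega>: "open \<Omega>" "bounded \<Omega>" using dom by (auto simp: lipschitz_domain_def)
  have V1: "L2_subspace \<Omega> V1" "L2_finite_dim \<Omega> V1" and V2: "L2_subspace \<Omega> V2"
    using fe by (auto simp: fe_space_def)
  have H: "V1 \<subseteq> H_curl \<Omega>" and curl_V2: "\<And>u. u \<in> V1 \<Longrightarrow> weak_curl \<Omega> u \<in> V2"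
    using complex by (auto simp: de_rham_subcomplex_def H0_curl_def)
  have L2: "\<And>u. u \<in> V1 \<Longrightarrow> u \<in> L2 \<Omega>" "\<And>w. w \<in> V2 \<Longrightarrow> w \<in> L2 \<Omega>"
    using V1 V2 by (auto simp: L2_subspace_def)
  have B_curl: "L2_eq \<Omega> (weak_curl \<Omega> (A (Suc n))) (B (Suc n))" for n
  proof -
    let ?c = "weak_curl \<Omega> (A (Suc n))"
    define C where "C = (\<lambda>x. B (Suc n) x - ?c x)"
    have c: "?c \<in> V2" using spaces curl_V2 by blast
    have C: "C \<in> V2" unfolding C_def using V2 spaces(1) c by (rule L2_subspace_diff)
    have "L2_inner \<Omega> C C = L2_inner \<Omega> (B (Suc n)) C - L2_inner \<Omega> ?c C"
      using L2.diff_left[OF L2(2)[OF spaces(1)] L2(2)[OF c] L2(2)[OF C]]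
      unfolding C_def .
    then have "L2_eq \<Omega> C (\<lambda>x. 0)"
      using eq_B[OF C, of n] L2_eq_0_iff[OF L2(2)[OF C]] by simp
    then show ?thesis
      unfolding L2_eq_def C_def by eventually_elim simp
  qed
  have energy_step: "energy \<Omega> B (Suc n) \<le> energy \<Omega> B n" for n
  proof -
    have "(energy \<Omega> B (Suc n) - energy \<Omega> B n) / dt \<le> 0"
      using eq_energy[of n] pos(2) by (smt (verit) mult_nonneg_nonneg zero_le_power2)
    then show ?thesis using pos(1) by (simp add: divide_le_0_iff)
  qed
  have Gauss: "L2_eq \<Omega> (weak_div \<Omega> (B (Suc n))) (\<lambda>x. 0)" for n
    using exact B_curl[of n] spaces unfolding exact_complex_def by blast
  have helicity_0: "helicity \<Omega> A B n = helicity \<Omega> A B 0" for n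
    using eq_helicity by (induction n) (simp_all add: algebra_simps)
  obtain C where C: "C \<ge> 0" "\<And>u. u \<in> V1 \<Longrightarrow> \<bar>L2_inner \<Omega> u (weak_curl \<Omega> u)\<bar>
      \<le> C * L2_inner \<Omega> (weak_curl \<Omega> u) (weak_curl \<Omega> u)"
    using discrete_Arnold_inequality[OF \<Omega> V1 complex exact] by blast
  have energy_nonneg: "energy \<Omega> B n \<ge> 0" for n
    by (simp add: energy_def L2_inner_nonneg)
  have Arnold_Suc: "\<bar>helicity \<Omega> A B (Suc n)\<bar> \<le> C * energy \<Omega> B (Suc n)" for n
  proof -
    have c: "weak_curl \<Omega> (A (Suc n)) \<in> L2 \<Omega>" using L2(2) curl_V2 spaces(2) by blast
    have cong: "L2_inner \<Omega> (B (Suc n)) w = L2_inner \<Omega> (weak_curl \<Omega> (A (Suc n))) w" if "w \<in> L2 \<Omega>" for w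
      using L2_inner_cong[OF B_curl c L2(2)[OF spaces(1)] that] by simp
    have "helicity \<Omega> A B (Suc n) = L2_inner \<Omega> (A (Suc n)) (weak_curl \<Omega> (A (Suc n)))"
      using cong[OF L2(1)[OF spaces(2)[of n]]] unfolding helicity_def
      by (simp only: L2_inner_commute[of \<Omega> "A (Suc n)"])
    moreover have "energy \<Omega> B (Suc n) =
        L2_inner \<Omega> (weak_curl \<Omega> (A (Suc n))) (weak_curl \<Omega> (A (Suc n)))"
      using cong[OF L2(2)[OF spaces(1)[of n]]] cong[OF c] L2_inner_commute unfolding energy_def
      by metis
    ultimately show ?thesis using C(2)[OF spaces(2)[of n]] by simp
  qed
  \<comment> \<open>If the initial energy is 0, the quotient is 0 and the initial helicity vanishes.\<close>
  define C' where "C' = C + 1 + \<bar>helicity \<Omega> A B 0\<bar> / energy \<Omega> B 0"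
  have C'_ge: "C' \<ge> C" "C' > 0" "C' \<ge> \<bar>helicity \<Omega> A B 0\<bar> / energy \<Omega> B 0"
    using C(1) energy_nonneg[of 0] by (auto simp: C'_def intro: add_nonneg_nonneg add_pos_nonneg)
  have "\<bar>helicity \<Omega> A B n\<bar> \<le> C' * energy \<Omega> B n" for n
  proof (cases n)
    case 0
    show ?thesis
    proof (cases "energy \<Omega> B 0 = 0")
      case True
      then have "helicity \<Omega> A B 0 = 0"
        using L2.Cauchy_Schwarz[OF L2(1)[OF init(2)] L2(2)[OF init(1)]]
        by (simp add: energy_def helicity_def)
      then show ?thesis using 0 True by simp
    next
      case False
      then have "energy \<Omega> B 0 > 0" using energy_nonneg[of 0] by simp
      then show ?thesis using 0 C'_ge(3) by (simp add: pos_divide_le_eq)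
    qed
  next
    case (Suc m)
    have "C * energy \<Omega> B n \<le> C' * energy \<Omega> B n"
      by (intro mult_right_mono C'_ge energy_nonneg)
    then show ?thesis using Arnold_Suc[of m] Suc by simp
  qed
  then have "\<exists>C>0. \<forall>n. \<bar>helicity \<Omega> A B n\<bar> \<le> C * energy \<Omega> B n"
    using C'_ge(2) by blast
  moreover have "helicity \<Omega> A B (Suc n) = helicity \<Omega> A B n \<and> helicity \<Omega> A B n = helicity \<Omega> A B 0" for n
    using helicity_0[of n] helicity_0[of "Suc n"] by simp
  moreover have "decseq (energy \<Omega> B)"
    using energy_step by (rule decseq_SucI)
  ultimately show ?thesis
    using energy_step Gauss by blast
qed

end
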